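(* The following identities of meromorphic functions of $\tau\in\mathbb{H}$ hold: $$\frac{\vartheta_2^2(\pi/10,\tau)}{\vartheta_3^2(\pi/10,\tau)}+\frac{\vartheta_2^2(3\pi/10,\tau)}{\vartheta_3^2(3\pi/10,\tau)}=\frac{5\vartheta_2(0,5\tau)\vartheta_3(0,5\tau)}{6\vartheta_2^2(0,\tau)\vartheta_3^2(0,\tau)}\cdot\frac{\vartheta_3^4(0,\tau)+\vartheta_2^4(0,\tau)-25\left(\vartheta_3^4(0,5\tau)+\vartheta_2^4(0,5\tau)\right)}{5\vartheta_2(0,5\tau)\vartheta_3(0,5\tau)-\vartheta_2(0,\tau)\vartheta_3(0,\tau)}$$ and $$\frac{\vartheta_2^2(\pi/10,\tau)}{\vartheta_3^2(\pi/10,\tau)}\cdot\frac{\vartheta_2^2(3\pi/10,\tau)}{\vartheta_3^2(3\pi/10,\tau)}=\frac{5\vartheta_2(0,5\tau)\vartheta_3(0,5\tau)}{\vartheta_2(0,\tau)\vartheta_3(0,\tau)}.$$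
   Context: $\mathbb{H}$ is the open upper half plane. For $\tau\in\mathbb{H}$, with $q=e^{2\pi i\tau}$ and $q^s=e^{2\pi i s\tau}$, $$\vartheta_2(v,\tau)=\sum_{m=-\infty}^\infty q^{(m+1/2)^2}e^{(2m+1)iv},\qquad \vartheta_3(v,\tau)=\sum_{m=-\infty}^\infty q^{m^2}e^{2miv}.$$ *)

theory Defs
  imports "HOL-Complex_Analysis.Complex_Analysis"
begin

definition upper_half_plane :: "complex set" where
  "upper_half_plane = {\<tau>. Im \<tau> > 0}"

(* The nome is q = exp (2 * pi * \<i> * \<tau>), not the more common exp (pi * \<i> * \<tau>). The
   fractional powers of q are fixed through the exponential; a principal power of q would
   give the wrong branch. *)
definition q_pow :: "complex \<Rightarrow> real \<Rightarrow> complex" where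
  "q_pow \<tau> s = exp (2 * of_real pi * \<i> * of_real s * \<tau>)"

definition theta2 :: "complex \<Rightarrow> complex \<Rightarrow> complex" where
  "theta2 v \<tau> = (\<Sum>\<^sub>\<infinity>m::int.
     q_pow \<tau> ((of_int m + 1 / 2) ^ 2) * exp ((2 * of_int m + 1) * \<i> * v))"

definition theta3 :: "complex \<Rightarrow> complex \<Rightarrow> complex" where
  "theta3 v \<tau> = (\<Sum>\<^sub>\<infinity>m::int.
     q_pow \<tau> ((of_int m) ^ 2) * exp (2 * of_int m * \<i> * v))"

(* Equality of meromorphic functions on S. HOL functions are total, with x / 0 = 0, so the
   values at poles and at removable singularities of the written expressions carry no meaning;
   the functions have to agree outside a set without limit points in S. *)
definition meromorphic_identity_on :: "complex set \<Rightarrow> (complex \<Rightarrow> complex) \<Rightarrow> (complex \<Rightarrow> complex) \<Rightarrow> bool"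
  where
  "meromorphic_identity_on S f g \<longleftrightarrow>
     f meromorphic_on S \<and> g meromorphic_on S \<and> (\<forall>\<^sub>\<approx>\<tau>\<in>S. f \<tau> = g \<tau>)"

end

theory Submission
  imports Defs
begin

text \<open>
  Put \<open>\<theta>\<^sub>1(v) = \<theta>\<^sub>2(v - \<pi>/2)\<close>, \<open>\<theta>\<^sub>4(v) = \<theta>\<^sub>3(v - \<pi>/2)\<close> and \<open>X(v) = \<theta>\<^sub>1(v)\<^sup>2 / \<theta>\<^sub>4(v)\<^sup>2\<close>, which is
  \<open>k sn\<^sup>2\<close> in Jacobi's notation. The two quotients in the theorem are \<open>b = X(2\<pi>/5)\<close> and \<open>a = X(\<pi>/5)\<close>,
  the values of \<open>X\<close> at 5-torsion points. Multiplying five translates of a theta function by \<open>\<pi>/5\<close>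
  gives the theta function of \<open>5v\<close> and \<open>5\<tau>\<close>, up to a factor \<open>C\<close> that is the same for \<open>\<theta>\<^sub>1\<close> and \<open>\<theta>\<^sub>4\<close>
  (\<open>theta3_product\<close>, \<open>theta_quintic\<close>). Both identities follow from the behaviour of this
  product formula as \<open>v\<close> tends to 0.

  \<^item> To first order it expresses \<open>a b\<close> through the derivatives \<open>\<theta>\<^sub>1'(0)\<close> at \<open>\<tau>\<close> and \<open>5\<tau>\<close>, and Jacobi's
    formula \<open>\<theta>\<^sub>1' = \<theta>\<^sub>2 \<theta>\<^sub>3 \<theta>\<^sub>4\<close> (\<open>jacobi_derivative_near_cusp\<close>) turns the result into the product
    identity.

  \<^item> The addition formulas say that \<open>X(v+w) X(v-w)\<close> is a rational function of \<open>X(v)\<close> and \<open>X(w)\<close>, so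
    the product formula becomes \<open>X(5v, 5\<tau>) = \<Phi>(X(v, \<tau>))\<close> with a rational map \<open>\<Phi>\<close> that depends on \<open>a\<close>
    and \<open>b\<close> only. Doubling \<open>v\<close> acts on \<open>X\<close> through another rational map \<open>D\<^sub>s\<close>, whose only parameter
    is \<open>s = k + 1/k\<close>. Doubling commutes with multiplication by 5, and comparing the coefficients of
    \<open>X\<^sup>2\<close> in \<open>\<Phi> \<circ> D\<^sub>s = D\<^sub>s\<^sub>' \<circ> \<Phi>\<close> gives \<open>6 (a + b) (a b - 1) = a b (s - s' (a b)\<^sup>2)\<close>, where \<open>s'\<close> is taken
    at \<open>5\<tau>\<close> (\<open>quintic_double_coefficient\<close>). With the product identity this is the sum identity.

  All this is carried out for \<open>\<tau>\<close> high in the half plane, where every theta value that occurs in a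
  denominator is visibly nonzero; the identity theorem for meromorphic functions then extends both
  identities to the whole half plane (\<open>meromorphic_identity_onI_cusp\<close>).
\<close>

section \<open>Bilateral series with quadratic exponents\<close>

lemma summable_on_int_abs:
  fixes f :: "nat \<Rightarrow> real"
  assumes "summable f" and nonneg: "\<And>n. f n \<ge> 0"
  shows "(\<lambda>m::int. f (nat \<bar>m\<bar>)) summable_on UNIV"
proof -
  have f: "f summable_on UNIV"
    using assms by (simp add: summable_on_UNIV_nonneg_real_iff)
  have "(\<lambda>m::int. f (nat \<bar>m\<bar>)) summable_on {0..} \<longleftrightarrow> f summable_on UNIV"
    by (rule summable_on_reindex_bij_witness[of _ int nat]) auto
  moreover have "(\<lambda>m::int. f (nat \<bar>m\<bar>)) summable_on {..<0} \<longleftrightarrow> f summable_on {1..}"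
    by (rule summable_on_reindex_bij_witness[of _ "\<lambda>n. - int n" "\<lambda>m. nat (-m)"]) auto
  moreover have "f summable_on {1..}"
    using f by (rule summable_on_subset_banach) auto
  ultimately have "(\<lambda>m::int. f (nat \<bar>m\<bar>)) summable_on ({0..} \<union> {..<0})"
    using f by (intro summable_on_Un_disjoint) auto
  moreover have "{0..} \<union> {..<0} = (UNIV :: int set)" by auto
  ultimately show ?thesis by simp
qed

text \<open>
  The \<open>n\<close>-th term is essentially \<open>(r\<^sup>n\<^sup>-\<^sup>1 K)\<^sup>n\<close>, and the base of this power tends to 0, so that no
  geometric growth \<open>K\<^sup>n\<close> of the coefficients can spoil convergence.
\<close>

lemma summable_on_gauss_majorant:
  fixes r K A :: real
  assumes "0 \<le> r" "r < 1" "K \<ge> 0"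
  shows "(\<lambda>m::int. r ^ (nat \<bar>m\<bar> * (nat \<bar>m\<bar> - 1)) * (A * K ^ nat \<bar>m\<bar>)) summable_on UNIV"
proof -
  define g where "g = (\<lambda>n. r ^ (n * (n - 1)) * K ^ n)"
  have "(\<lambda>n. r ^ n * K) \<longlonglongrightarrow> 0 * K"
    using assms by (intro tendsto_mult LIMSEQ_realpow_zero) auto
  hence "eventually (\<lambda>n. r ^ n * K < 1/2) sequentially"
    by (rule order_tendstoD) auto
  hence "eventually (\<lambda>n. r ^ (n - 1) * K < 1/2) sequentially"
    using eventually_sequentially_seg[of "\<lambda>n. r ^ (n - 1) * K < 1/2" 1] by simp
  hence ev: "eventually (\<lambda>n. norm (g n) \<le> (1/2) ^ n) sequentially"
  proof eventually_elim
    case (elim n)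
    have "g n = (r ^ (n - 1) * K) ^ n"
      by (simp add: g_def power_mult_distrib power_mult[symmetric] mult.commute)
    also have "\<dots> \<le> (1/2) ^ n"
      using elim assms by (intro power_mono) auto
    finally show ?case using assms by (simp add: g_def)
  qed
  have "summable g"
    using ev by (rule summable_comparison_test_ev) (simp add: summable_geometric)
  moreover have "g n \<ge> 0" for n using assms by (simp add: g_def)
  ultimately have "(\<lambda>m::int. g (nat \<bar>m\<bar>)) summable_on UNIV"
    by (rule summable_on_int_abs)
  hence "(\<lambda>m::int. A * g (nat \<bar>m\<bar>)) summable_on UNIV"
    by (rule summable_on_cmult_right)
  thus ?thesis by (simp add: g_def mult_ac)
qed

text \<open>
  Weierstrass' theorem: locally uniform convergence of holomorphic functions passes to the
  derivatives, so a dominated series may be differentiated term by term.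
\<close>

lemma infsum_has_field_derivative:
  fixes f f' :: "'a \<Rightarrow> complex \<Rightarrow> complex"
  assumes "r > 0"
    and der: "\<And>m z. z \<in> cball a r \<Longrightarrow> (f m has_field_derivative f' m z) (at z)"
    and bound: "\<And>m z. z \<in> cball a r \<Longrightarrow> norm (f m z) \<le> M m"
    and "M summable_on UNIV"
  shows "((\<lambda>z. \<Sum>\<^sub>\<infinity>m. f m z) has_field_derivative (\<Sum>\<^sub>\<infinity>m. f' m a)) (at a)"
proof -
  let ?F = "finite_subsets_at_top (UNIV :: 'a set)"
  have lim: "uniform_limit (cball a r) (\<lambda>X z. \<Sum>m\<in>X. f m z) (\<lambda>z. \<Sum>\<^sub>\<infinity>m. f m z) ?F"
    by (rule Weierstrass_m_test_general[OF bound]) (use assms in auto)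
  have cont: "continuous_on (cball a r) (f m)" for m
    using der by (intro continuous_at_imp_continuous_on ballI DERIV_isCont) auto
  have "eventually (\<lambda>X. continuous_on (cball a r) (\<lambda>z. \<Sum>m\<in>X. f m z) \<and>
          (\<forall>z\<in>ball a r. ((\<lambda>z. \<Sum>m\<in>X. f m z) has_field_derivative (\<Sum>m\<in>X. f' m z)) (at z))) ?F"
    by (intro always_eventually allI conjI ballI continuous_on_sum cont DERIV_sum der) auto
  then obtain g' where g':
    "\<And>z. z \<in> ball a r \<Longrightarrow> ((\<lambda>z. \<Sum>\<^sub>\<infinity>m. f m z) has_field_derivative g' z) (at z) \<and>
        ((\<lambda>X. \<Sum>m\<in>X. f' m z) \<longlongrightarrow> g' z) ?F"
    by (rule has_complex_derivative_uniform_limit[OF _ lim _ \<open>r > 0\<close>]) auto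
  have "((\<lambda>m. f' m a) has_sum g' a) UNIV"
    using g'[of a] \<open>r > 0\<close> by (simp add: has_sum_def)
  hence "(\<Sum>\<^sub>\<infinity>m. f' m a) = g' a" by (rule infsumI)
  thus ?thesis using g'[of a] \<open>r > 0\<close> by simp
qed

text \<open>
  All theta series that occur, and their derivatives in \<open>v\<close>, are of this shape: a power series in the
  nome \<open>w\<close> whose exponents \<open>k m\<close> grow quadratically. The lower bound \<open>\<bar>m\<bar> (\<bar>m\<bar> - 1)\<close> is weak enough to
  cover both \<open>m\<^sup>2\<close> and \<open>m\<^sup>2 + m\<close>.
\<close>

locale gauss_series =
  fixes k :: "int \<Rightarrow> nat" and c :: "int \<Rightarrow> complex" and A K :: real
  assumes K: "K \<ge> 0" and k: "k m \<ge> nat \<bar>m\<bar> * (nat \<bar>m\<bar> - 1)"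
    and c: "norm (c m) \<le> A * K ^ nat \<bar>m\<bar>"
begin

lemma term_bound:
  assumes "norm w \<le> r" "r < 1"
  shows "norm (w ^ k m * c m) \<le> r ^ (nat \<bar>m\<bar> * (nat \<bar>m\<bar> - 1)) * (A * K ^ nat \<bar>m\<bar>)"
proof -
  have r: "0 \<le> r" using assms norm_ge_zero[of w] by linarith
  have "norm w ^ k m \<le> r ^ k m" using assms by (intro power_mono) auto
  also have "\<dots> \<le> r ^ (nat \<bar>m\<bar> * (nat \<bar>m\<bar> - 1))"
    using k r assms by (intro power_decreasing) auto
  finally show ?thesis
    using c[of m] r by (auto simp: norm_mult norm_power intro!: mult_mono)
qed

lemma abs_summable:
  assumes "norm w < 1"
  shows "(\<lambda>m. norm (w ^ k m * c m)) summable_on UNIV"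
  by (rule Infinite_Sum.abs_summable_on_comparison_test'[OF summable_on_gauss_majorant[of "norm w" K A]])
     (use assms K term_bound[of w "norm w"] in auto)

lemma holomorphic: "(\<lambda>w. \<Sum>\<^sub>\<infinity>m. w ^ k m * c m) holomorphic_on ball 0 1"
  unfolding holomorphic_on_def
proof
  fix w :: complex assume "w \<in> ball 0 1"
  define r where "r = (1 - norm w) / 2"
  have r: "r > 0" "norm w + r < 1" using \<open>w \<in> ball 0 1\<close> by (auto simp: r_def field_simps)
  have "((\<lambda>w. \<Sum>\<^sub>\<infinity>m. w ^ k m * c m) has_field_derivative
          (\<Sum>\<^sub>\<infinity>m. of_nat (k m) * w ^ (k m - 1) * c m)) (at w)"
  proof (rule infsum_has_field_derivative[OF r(1)])
    fix m z assume z: "z \<in> cball w r"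
    show "((\<lambda>w. w ^ k m * c m) has_field_derivative of_nat (k m) * z ^ (k m - 1) * c m) (at z)"
      by (auto intro!: derivative_eq_intros)
    have "norm z \<le> norm w + r" using z norm_triangle_ineq2[of z w] by (auto simp: dist_norm norm_minus_commute)
    thus "norm (z ^ k m * c m) \<le> (norm w + r) ^ (nat \<bar>m\<bar> * (nat \<bar>m\<bar> - 1)) * (A * K ^ nat \<bar>m\<bar>)"
      using r by (intro term_bound) auto
  qed (use r K summable_on_gauss_majorant[of "norm w + r" K A] in auto)
  thus "(\<lambda>w. \<Sum>\<^sub>\<infinity>m. w ^ k m * c m) field_differentiable at w within ball 0 1" 
    using field_differentiable_at_within field_differentiable_def by blast
qed

end

section \<open>Theta functions of the nome\<close>

definition nome :: "complex \<Rightarrow> complex" where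
  "nome \<tau> = exp (2 * of_real pi * \<i> * \<tau>)"

text \<open>
  The theta functions as functions of the nome. The exponents \<open>m\<^sup>2 + m\<close> are those of \<open>\<theta>\<^sub>2\<close> after removal
  of the factor \<open>q\<^sup>1\<^sup>/\<^sup>4\<close>, which makes them natural numbers; the series is then holomorphic at nome 0,
  and the limit \<open>\<tau> \<rightarrow> \<i>\<infinity>\<close> becomes an evaluation at 0.
\<close>

definition theta2_nome :: "complex \<Rightarrow> complex \<Rightarrow> complex" where
  "theta2_nome v w = (\<Sum>\<^sub>\<infinity>m::int. w ^ nat (m^2 + m) * exp ((2 * of_int m + 1) * \<i> * v))"

definition theta2_nome_deriv :: "complex \<Rightarrow> complex \<Rightarrow> complex" where
  "theta2_nome_deriv v w = (\<Sum>\<^sub>\<infinity>m::int. w ^ nat (m^2 + m) *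
     ((2 * of_int m + 1) * \<i> * exp ((2 * of_int m + 1) * \<i> * v)))"

definition theta3_nome :: "complex \<Rightarrow> complex \<Rightarrow> complex" where
  "theta3_nome v w = (\<Sum>\<^sub>\<infinity>m::int. w ^ nat (m^2) * exp (2 * of_int m * \<i> * v))"

lemma norm_nome_less_1_iff: "norm (nome \<tau>) < 1 \<longleftrightarrow> Im \<tau> > 0"
  by (simp add: nome_def zero_less_mult_iff)

lemma norm_nome_less_1: "Im \<tau> > 0 \<Longrightarrow> norm (nome \<tau>) < 1"
  by (simp add: norm_nome_less_1_iff)

lemma q_pow_nat: "q_pow \<tau> (real n) = nome \<tau> ^ n"
  by (simp add: q_pow_def nome_def mult_ac flip: exp_of_nat_mult)

lemma q_pow_nonzero [simp]: "q_pow \<tau> s \<noteq> 0"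
  by (simp add: q_pow_def)

lemma theta3_conv_nome: "theta3 v \<tau> = theta3_nome v (nome \<tau>)"
proof -
  have "q_pow \<tau> (of_int m ^ 2) = nome \<tau> ^ nat (m^2)" for m :: int
    using q_pow_nat[of \<tau> "nat (m^2)"] by simp
  thus ?thesis by (simp add: theta3_def theta3_nome_def)
qed

lemma theta2_conv_nome: "theta2 v \<tau> = q_pow \<tau> (1/4) * theta2_nome v (nome \<tau>)"
proof -
  have "q_pow \<tau> ((of_int m + 1/2) ^ 2) = q_pow \<tau> (1/4) * nome \<tau> ^ nat (m^2 + m)" for m :: int
  proof -
    have "m\<^sup>2 + m = m * (m + 1)" by (simp add: power2_eq_square algebra_simps)
    hence "m\<^sup>2 + m \<ge> 0" by (auto simp: zero_le_mult_iff)
    hence "nome \<tau> ^ nat (m^2 + m) = q_pow \<tau> (of_int m ^ 2 + of_int m)"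
      using q_pow_nat[of \<tau> "nat (m^2 + m)"] by simp
    thus ?thesis
      by (simp add: q_pow_def power2_eq_square algebra_simps flip: exp_add)
  qed
  thus ?thesis
    by (simp add: theta2_def theta2_nome_def mult.assoc infsum_cmult_right')
qed

lemma norm_exp_linear_le:
  assumes "norm v \<le> R" 
  shows "norm (exp (2 * of_int m * \<i> * v)) \<le> 1 * exp (2 * R) ^ nat \<bar>m\<bar>"
    and "norm (exp ((2 * of_int m + 1) * \<i> * v)) \<le> exp R * exp (2 * R) ^ nat \<bar>m\<bar>"
proof -
  have v: "\<bar>Im v\<bar> \<le> R" using assms abs_Im_le_cmod[of v] by linarith
  have "- (2 * real_of_int m * Im v) \<le> 2 * \<bar>of_int m * Im v\<bar>"
    using abs_ge_minus_self[of "real_of_int m * Im v"] unfolding mult.assoc by linarith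
  also have "\<dots> = 2 * (\<bar>of_int m\<bar> * \<bar>Im v\<bar>)"
    by (simp add: flip: abs_mult)
  also have "\<dots> \<le> 2 * (\<bar>of_int m\<bar> * R)"
    using v by (intro mult_left_mono) auto
  finally have *: "- (2 * real_of_int m * Im v) \<le> 2 * (\<bar>of_int m\<bar> * R)" .
  have e: "exp (2 * R) ^ nat \<bar>m\<bar> = exp (2 * (\<bar>of_int m\<bar> * R))"
    by (simp add: mult_ac flip: exp_of_nat_mult)
  show "norm (exp (2 * of_int m * \<i> * v)) \<le> 1 * exp (2 * R) ^ nat \<bar>m\<bar>"
    using * unfolding e by simp
  show "norm (exp ((2 * of_int m + 1) * \<i> * v)) \<le> exp R * exp (2 * R) ^ nat \<bar>m\<bar>"
    using * v unfolding e by (simp add: algebra_simps flip: exp_add)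
qed

lemma odd_le_power3: "2 * real n + 1 \<le> 3 ^ n"
  by (induction n) auto

lemma norm_exp_linear_deriv_le:
  assumes "norm v \<le> R" 
  shows "norm ((2 * of_int m + 1) * \<i> * exp ((2 * of_int m + 1) * \<i> * v))
           \<le> exp R * (3 * exp (2 * R)) ^ nat \<bar>m\<bar>"
proof -
  have "norm ((2 * of_int m + 1) * \<i> :: complex) = \<bar>real_of_int (2 * m + 1)\<bar>"
    by (subst norm_mult, subst norm_of_int[symmetric]) simp
  also have "\<dots> \<le> 2 * real (nat \<bar>m\<bar>) + 1" by simp
  also have "\<dots> \<le> 3 ^ nat \<bar>m\<bar>" by (rule odd_le_power3)
  finally have "norm ((2 * of_int m + 1) * \<i> :: complex) \<le> 3 ^ nat \<bar>m\<bar>" .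
  from mult_mono[OF this norm_exp_linear_le(2)[OF assms, of m]] show ?thesis
    by (simp add: norm_mult power_mult_distrib mult_ac)
qed

lemma nat_square_ge: "nat (m^2) \<ge> nat \<bar>m\<bar> * (nat \<bar>m\<bar> - 1)"
proof -
  have "nat \<bar>m\<bar> * (nat \<bar>m\<bar> - 1) \<le> nat \<bar>m\<bar> * nat \<bar>m\<bar>" by (intro mult_left_mono) auto
  also have "\<dots> = nat (m^2)" by (simp add: power2_eq_square flip: nat_mult_distrib abs_mult)
  finally show ?thesis .
qed

lemma nat_pronic_ge: "nat (m^2 + m) \<ge> nat \<bar>m\<bar> * (nat \<bar>m\<bar> - 1)"
proof -
  have "int (nat \<bar>m\<bar> * (nat \<bar>m\<bar> - 1)) \<le> m^2 + m"
    by (cases "m = 0") (auto simp: of_nat_diff power2_eq_square algebra_simps abs_if)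
  thus ?thesis by linarith
qed

lemma gauss_series_theta:
  assumes "norm v \<le> R"
  shows "gauss_series (\<lambda>m. nat (m^2)) (\<lambda>m. exp (2 * of_int m * \<i> * v)) 1 (exp (2 * R))"
    and "gauss_series (\<lambda>m. nat (m^2 + m)) (\<lambda>m. exp ((2 * of_int m + 1) * \<i> * v))
           (exp R) (exp (2 * R))"
    and "gauss_series (\<lambda>m. nat (m^2 + m))
           (\<lambda>m. (2 * of_int m + 1) * \<i> * exp ((2 * of_int m + 1) * \<i> * v))
           (exp R) (3 * exp (2 * R))"
  by (unfold_locales; use norm_exp_linear_le[OF assms] norm_exp_linear_deriv_le[OF assms]
      nat_square_ge nat_pronic_ge in simp)+

lemma holomorphic_theta_nome:
  shows "theta3_nome v holomorphic_on ball 0 1"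
    and "theta2_nome v holomorphic_on ball 0 1"
    and "theta2_nome_deriv v holomorphic_on ball 0 1"
  unfolding theta3_nome_def[abs_def] theta2_nome_def[abs_def] theta2_nome_deriv_def[abs_def]
  by (rule gauss_series.holomorphic[OF gauss_series_theta(1)[OF order.refl]]
           gauss_series.holomorphic[OF gauss_series_theta(2)[OF order.refl]]
           gauss_series.holomorphic[OF gauss_series_theta(3)[OF order.refl]])+

lemma theta_nome_at_0:
  shows "theta3_nome v 0 = 1"
    and "theta2_nome v 0 = 2 * cos v"
    and "theta2_nome_deriv v 0 = - 2 * sin v"
proof -
  have pronic: "0 < m\<^sup>2 + m" if "m \<noteq> 0" "m \<noteq> -1" for m :: int
  proof -
    have "m\<^sup>2 + m = m * (m + 1)" by (simp add: power2_eq_square algebra_simps)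
    thus ?thesis using that by (auto simp: zero_less_mult_iff)
  qed
  have "theta3_nome v 0 = (\<Sum>\<^sub>\<infinity>m\<in>{0::int}. 1)"
    unfolding theta3_nome_def by (rule infsum_cong_neutral) (auto simp: power_0_left)
  thus "theta3_nome v 0 = 1" by simp
  have "theta2_nome v 0 = (\<Sum>\<^sub>\<infinity>m\<in>{0, -1::int}. exp ((2 * of_int m + 1) * \<i> * v))"
    unfolding theta2_nome_def 
    by (rule infsum_cong_neutral) (use pronic in \<open>force simp: power_0_left\<close>)+
  thus "theta2_nome v 0 = 2 * cos v" by (simp add: cos_exp_eq)
  have "theta2_nome_deriv v 0 = (\<Sum>\<^sub>\<infinity>m\<in>{0, -1::int}. (2 * of_int m + 1) * \<i> * exp ((2 * of_int m + 1) * \<i> * v))"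
    unfolding theta2_nome_deriv_def 
    by (rule infsum_cong_neutral) (use pronic in \<open>force simp: power_0_left\<close>)+
  moreover have "2 * sin v = - \<i> * (exp (\<i> * v) - exp (- (\<i> * v)))"
    by (simp add: sin_exp_eq)
  ultimately show "theta2_nome_deriv v 0 = - 2 * sin v" by (simp add: right_diff_distrib)
qed

lemma theta2_nome_has_deriv:
  assumes "norm w < 1"
  shows "((\<lambda>v. theta2_nome v w) has_field_derivative theta2_nome_deriv v w) (at v)"
  unfolding theta2_nome_def theta2_nome_deriv_def
proof (rule infsum_has_field_derivative[of 1])
  fix m :: int and z assume z: "z \<in> cball v 1"
  have z': "norm z \<le> norm v + 1"
    using z norm_triangle_ineq2[of z v] by (auto simp: dist_norm norm_minus_commute)
  show "norm (w ^ nat (m^2 + m) * exp ((2 * of_int m + 1) * \<i> * z)) \<le> norm w ^ (nat \<bar>m\<bar> * (nat \<bar>m\<bar> - 1)) *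
          (exp (norm v + 1) * exp (2 * (norm v + 1)) ^ nat \<bar>m\<bar>)"
    using gauss_series.term_bound[OF gauss_series_theta(2)[OF z'] order.refl assms] .
qed (use assms summable_on_gauss_majorant[of "norm w"] in \<open>auto intro!: derivative_eq_intros\<close>)

lemma theta3_nome_differentiable:
  assumes "norm w < 1"
  shows "(\<lambda>v. theta3_nome v w) field_differentiable at v"
  unfolding theta3_nome_def field_differentiable_def
proof (rule exI, rule infsum_has_field_derivative[of 1])
  fix m :: int and z assume z: "z \<in> cball v 1"
  have z': "norm z \<le> norm v + 1"
    using z norm_triangle_ineq2[of z v] by (auto simp: dist_norm norm_minus_commute)
  show "norm (w ^ nat (m^2) * exp (2 * of_int m * \<i> * z)) \<le> norm w ^ (nat \<bar>m\<bar> * (nat \<bar>m\<bar> - 1)) *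
          (1 * exp (2 * (norm v + 1)) ^ nat \<bar>m\<bar>)"
    using gauss_series.term_bound[OF gauss_series_theta(1)[OF z'] order.refl assms] .
  show "((\<lambda>v. w ^ nat (m^2) * exp (2 * of_int m * \<i> * v)) has_field_derivative 
      w ^ nat (m^2) * (2 * of_int m * \<i> * exp (2 * of_int m * \<i> * z))) (at z)"
    by (auto intro!: derivative_eq_intros)
qed (use assms summable_on_gauss_majorant[of "norm w" "exp (2 * (norm v + 1))" 1] in auto)

lemma theta3_abs_summable:
  assumes "Im \<tau> > 0"
  shows "(\<lambda>m::int. norm (q_pow \<tau> (of_int m ^ 2) * exp (2 * of_int m * \<i> * v))) summable_on UNIV"
proof -
  have "q_pow \<tau> (of_int m ^ 2) = nome \<tau> ^ nat (m^2)" for m :: int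
    using q_pow_nat[of \<tau> "nat (m^2)"] by simp
  thus ?thesis
    using gauss_series.abs_summable[OF gauss_series_theta(1)[OF order.refl] norm_nome_less_1[OF assms]]
    by simp
qed

section \<open>Translations by half periods\<close>

lemma theta2_conv_theta3: "theta2 v \<tau> = q_pow \<tau> (1/4) * exp (\<i> * v) * theta3 (v + of_real pi * \<tau>) \<tau>"
  unfolding theta2_def theta3_def infsum_cmult_right'[symmetric]
  by (rule infsum_cong, simp add: q_pow_def flip: exp_add, rule arg_cong[of _ _ exp])
     (simp add: power2_eq_square field_simps)

lemma theta3_plus_2pi_tau:
  "theta3 (v + 2 * of_real pi * \<tau>) \<tau> = q_pow \<tau> (-1) * exp (-2 * \<i> * v) * theta3 v \<tau>"
  unfolding theta3_def infsum_cmult_right'[symmetric]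
  by (rule infsum_reindex_bij_witness[of _ "\<lambda>m. m - 1" "\<lambda>m. m + 1"])
     (auto simp add: q_pow_def power2_eq_square field_simps simp flip: exp_add)

lemma theta3_plus_pi: "theta3 (v + of_real pi) \<tau> = theta3 v \<tau>"
proof -
  have "exp (2 * of_int m * \<i> * (v + of_real pi)) = exp (2 * of_int m * \<i> * v)" for m :: int
  proof -
    have "exp (2 * of_int m * \<i> * (v + of_real pi)) = 
            exp (2 * of_int m * \<i> * v) * exp (2 * of_int m * of_real pi * \<i>)"
      by (simp add: algebra_simps flip: exp_add)
    thus ?thesis using exp_integer_2pi[of "of_int m"] by simp
  qed
  thus ?thesis by (simp add: theta3_def)
qed

lemma theta2_plus_pi: "theta2 (v + of_real pi) \<tau> = - theta2 v \<tau>"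
  using theta3_plus_pi[of "v + of_real pi * \<tau>" \<tau>]
  by (simp add: theta2_conv_theta3 ring_distribs exp_add add_ac mult.commute[of \<i> "of_real pi"])

lemma theta2_plus_pi_tau:
  "theta2 (v + of_real pi * \<tau>) \<tau> = q_pow \<tau> (-1/4) * exp (-\<i> * v) * theta3 v \<tau>"
proof -
  have "theta2 (v + of_real pi * \<tau>) \<tau> = q_pow \<tau> (1/4) * exp (\<i> * (v + of_real pi * \<tau>)) *
           (q_pow \<tau> (-1) * exp (-2 * \<i> * v) * theta3 v \<tau>)"
    using theta3_plus_2pi_tau[of v \<tau>] by (simp add: theta2_conv_theta3 algebra_simps)
  also have "\<dots> = q_pow \<tau> (-1/4) * exp (-\<i> * v) * theta3 v \<tau>"
    by (simp add: q_pow_def algebra_simps flip: exp_add)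
  finally show ?thesis .
qed

lemma theta3_minus: "theta3 (-v) \<tau> = theta3 v \<tau>"
  unfolding theta3_def
  by (rule infsum_reindex_bij_witness[of _ uminus uminus]) auto

lemma theta2_minus: "theta2 (-v) \<tau> = theta2 v \<tau>"
  unfolding theta2_def
  by (rule infsum_reindex_bij_witness[of _ "\<lambda>m. -1 - m" "\<lambda>m. -1 - m"])
     (auto simp: power2_eq_square algebra_simps)

section \<open>Products of theta functions\<close>

lemma theta2_abs_summable:
  assumes "Im \<tau> > 0"
  shows "(\<lambda>m::int. norm (q_pow \<tau> ((of_int m + 1/2) ^ 2) * exp ((2 * of_int m + 1) * \<i> * v))) summable_on UNIV"
proof -
  have "q_pow \<tau> ((of_int m + 1/2) ^ 2) * exp ((2 * of_int m + 1) * \<i> * v) =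
          (q_pow \<tau> (1/4) * exp (\<i> * v)) * 
          (q_pow \<tau> (of_int m ^ 2) * exp (2 * of_int m * \<i> * (v + of_real pi * \<tau>)))" for m :: int
    by (simp add: q_pow_def flip: exp_add, rule arg_cong[of _ _ exp])
       (simp add: power2_eq_square field_simps)
  moreover have "(\<lambda>m::int. norm (q_pow \<tau> (1/4) * exp (\<i> * v)) *
      norm (q_pow \<tau> (of_int m ^ 2) * exp (2 * of_int m * \<i> * (v + of_real pi * \<tau>)))) summable_on UNIV"
    by (rule summable_on_cmult_right[OF theta3_abs_summable[OF assms]])
  ultimately show ?thesis by (simp only: norm_mult)
qed

lemma infsum_times_infsum:
  fixes f :: "'a \<Rightarrow> complex" and g :: "'b \<Rightarrow> complex"
  assumes f: "(\<lambda>x. norm (f x)) summable_on A" and g: "(\<lambda>y. norm (g y)) summable_on B"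
  shows "(\<lambda>(x, y). f x * g y) summable_on A \<times> B"
    and "(\<Sum>\<^sub>\<infinity>(x, y)\<in>A \<times> B. f x * g y) = infsum f A * infsum g B"
proof -
  have "(\<lambda>p. norm (case p of (x, y) \<Rightarrow> f x * g y)) summable_on A \<times> B"
    unfolding Infinite_Sum.abs_summable_on_Sigma_iff
    using f g by (simp add: norm_mult summable_on_cmult_right summable_on_cmult_left infsum_cmult_right'
        abs_mult infsum_nonneg)
  thus *: "(\<lambda>(x, y). f x * g y) summable_on A \<times> B"
    by (rule Infinite_Sum.abs_summable_summable)
  have "(\<Sum>\<^sub>\<infinity>(x, y)\<in>A \<times> B. f x * g y) = (\<Sum>\<^sub>\<infinity>x\<in>A. \<Sum>\<^sub>\<infinity>y\<in>B. f x * g y)"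
    by (rule infsum_Sigma'_banach[symmetric]) (rule *)
  thus "(\<Sum>\<^sub>\<infinity>(x, y)\<in>A \<times> B. f x * g y) = infsum f A * infsum g B"
    by (simp add: infsum_cmult_right' infsum_cmult_left')
qed

text \<open>
  The source of all addition formulas. The product is a sum over pairs \<open>(m, n)\<close>, and the substitution
  \<open>(m + n, m - n)\<close> diagonalises both \<open>m\<^sup>2 + n\<^sup>2\<close> and \<open>m (x + y) + n (x - y)\<close>. Its image consists of the
  pairs of equal parity: the even ones give the \<open>\<theta>\<^sub>3 \<theta>\<^sub>3\<close> term, the odd ones the \<open>\<theta>\<^sub>2 \<theta>\<^sub>2\<close> term.
\<close>

lemma theta3_times_theta3:
  assumes \<tau>: "Im \<tau> > 0"
  shows "theta3 (x + y) \<tau> * theta3 (x - y) \<tau> =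
           theta3 (2 * x) (2 * \<tau>) * theta3 (2 * y) (2 * \<tau>) +
           theta2 (2 * x) (2 * \<tau>) * theta2 (2 * y) (2 * \<tau>)"
proof -
  define a where "a = (\<lambda>\<tau> v m. q_pow \<tau> (of_int m ^ 2) * exp (2 * of_int m * \<i> * v))"
  define b where "b = (\<lambda>\<tau> v m. q_pow \<tau> ((of_int m + 1/2) ^ 2) * exp ((2 * of_int m + 1) * \<i> * v))"
  define F where "F = (\<lambda>(m, n). a \<tau> (x + y) m * a \<tau> (x - y) n)"
  \<comment> \<open>\<open>g\<close> and \<open>h\<close> parametrise the pairs with even and with odd sum, respectively.\<close>
  define g where "g = (\<lambda>(m, n). (m + n, m - n :: int))"
  define h where "h = (\<lambda>(m, n). (m + n + 1, m - n :: int))"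
  have \<tau>': "Im (2 * \<tau>) > 0" using \<tau> by simp
  have a: "(\<lambda>m. norm (a \<tau> v m)) summable_on UNIV" if "Im \<tau> > 0" for v \<tau>
    unfolding a_def by (rule theta3_abs_summable) fact
  have b: "(\<lambda>m. norm (b \<tau> v m)) summable_on UNIV" if "Im \<tau> > 0" for v \<tau>
    unfolding b_def by (rule theta2_abs_summable) fact
  have inj: "inj g" "inj h" by (auto simp: g_def h_def inj_on_def)
  have "p \<in> range g \<union> range h" for p
  proof -
    obtain m n where p: "p = (m, n)" by (cases p)
    show ?thesis
    proof (cases "even (m + n)")
      case True
      hence "p = g ((m + n) div 2, (m - n) div 2)"
        unfolding g_def p by (simp; presburger)
      thus ?thesis by blast
    next
      case False
      hence "p = h ((m + n) div 2, (m - n) div 2)"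
        unfolding h_def p by (auto elim!: oddE)
      thus ?thesis by blast
    qed
  qed
  hence UN: "range g \<union> range h = UNIV" by blast
  have disj: "range g \<inter> range h = {}"
    by (auto simp: g_def h_def) presburger
  have F: "F summable_on UNIV"
    using infsum_times_infsum(1)[OF a[OF \<tau>] a[OF \<tau>]] by (simp add: F_def)
  have "theta3 (x + y) \<tau> * theta3 (x - y) \<tau> = infsum F UNIV"
    using infsum_times_infsum(2)[OF a[OF \<tau>] a[OF \<tau>]]
    by (simp add: theta3_def F_def a_def)
  also have "\<dots> = infsum F (range g \<union> range h)"
    by (simp only: UN)
  also have "\<dots> = infsum F (range g) + infsum F (range h)"
    by (intro infsum_Un_disjoint disj summable_on_subset_banach[OF F]) auto
  also have "infsum F (range g) = infsum (\<lambda>(m, n). a (2 * \<tau>) (2 * x) m * a (2 * \<tau>) (2 * y) n) UNIV"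
    unfolding infsum_reindex[OF inj(1)]
    by (rule infsum_cong, clarsimp simp: F_def g_def a_def q_pow_def simp flip: exp_add, rule arg_cong[of _ _ exp])
       (simp add: power2_eq_square algebra_simps)
  also have "\<dots> = theta3 (2 * x) (2 * \<tau>) * theta3 (2 * y) (2 * \<tau>)"
    using infsum_times_infsum(2)[OF a[OF \<tau>', of "2 * x"] a[OF \<tau>', of "2 * y"]]
    by (simp add: theta3_def a_def)
  also have "infsum F (range h) = infsum (\<lambda>(m, n). b (2 * \<tau>) (2 * x) m * b (2 * \<tau>) (2 * y) n) UNIV"
    unfolding infsum_reindex[OF inj(2)]
    by (rule infsum_cong, clarsimp simp: F_def h_def a_def b_def q_pow_def simp flip: exp_add, rule arg_cong[of _ _ exp])
       (simp add: power2_eq_square field_simps)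
  also have "\<dots> = theta2 (2 * x) (2 * \<tau>) * theta2 (2 * y) (2 * \<tau>)"
    using infsum_times_infsum(2)[OF b[OF \<tau>', of "2 * x"] b[OF \<tau>', of "2 * y"]]
    by (simp add: theta2_def b_def)
  finally show ?thesis .
qed

text \<open>
  A translation of \<open>x\<close> by the half period \<open>\<pi>\<tau>\<close> carries the previous formula into this one.
\<close>

lemma theta2_times_theta2:
  assumes \<tau>: "Im \<tau> > 0"
  shows "theta2 (x + y) \<tau> * theta2 (x - y) \<tau> =
           theta3 (2 * x) (2 * \<tau>) * theta2 (2 * y) (2 * \<tau>) +
           theta2 (2 * x) (2 * \<tau>) * theta3 (2 * y) (2 * \<tau>)"
proof -
  define t where "t = of_real pi * \<tau>"
  have e: "q_pow \<tau> (1/4) * q_pow \<tau> (1/4) * exp (2 * \<i> * x) = 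
        q_pow (2 * \<tau>) (1/4) * exp (\<i> * (2 * x))"
       "q_pow \<tau> (1/4) * q_pow \<tau> (1/4) * exp (2 * \<i> * x) * (q_pow (2 * \<tau>) (-1/4) * exp (-\<i> * (2 * x))) = 1"
    by (simp_all add: q_pow_def algebra_simps flip: exp_add)
  have "theta2 (x + y) \<tau> * theta2 (x - y) \<tau> =
          q_pow \<tau> (1/4) * q_pow \<tau> (1/4) * exp (2 * \<i> * x) * 
          (theta3 (x + t + y) \<tau> * theta3 (x + t - y) \<tau>)"
    by (simp add: theta2_conv_theta3 t_def algebra_simps exp_add exp_diff)
       (simp add: mult_ac flip: exp_add)
  also have "\<dots> = q_pow \<tau> (1/4) * q_pow \<tau> (1/4) * exp (2 * \<i> * x) * 
          (theta3 (2 * x + of_real pi * (2 * \<tau>)) (2 * \<tau>) * theta3 (2 * y) (2 * \<tau>) +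
           theta2 (2 * x + of_real pi * (2 * \<tau>)) (2 * \<tau>) * theta2 (2 * y) (2 * \<tau>))"
    using theta3_times_theta3[OF \<tau>, of "x + t" y] by (simp add: t_def algebra_simps)
  also have "\<dots> = theta2 (2 * x) (2 * \<tau>) * theta3 (2 * y) (2 * \<tau>) +
     (q_pow \<tau> (1/4) * q_pow \<tau> (1/4) * exp (2 * \<i> * x) * (q_pow (2 * \<tau>) (-1/4) * exp (-\<i> * (2 * x)))) *
       theta3 (2 * x) (2 * \<tau>) * theta2 (2 * y) (2 * \<tau>)"
    unfolding theta2_plus_pi_tau theta2_conv_theta3[of "2 * x"] e(1)[symmetric]
    by (simp add: ring_distribs)
  finally show ?thesis unfolding e(2) by simp
qed

section \<open>Addition and duplication formulas\<close>

definition theta1 :: "complex \<Rightarrow> complex \<Rightarrow> complex" where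
  "theta1 v \<tau> = theta2 (v - of_real pi / 2) \<tau>"

definition theta4 :: "complex \<Rightarrow> complex \<Rightarrow> complex" where
  "theta4 v \<tau> = theta3 (v - of_real pi / 2) \<tau>"

lemma theta2_minus_pi: "theta2 (v - of_real pi) \<tau> = - theta2 v \<tau>"
  using theta2_plus_pi[of "v - of_real pi" \<tau>] by simp

lemma theta3_minus_pi: "theta3 (v - of_real pi) \<tau> = theta3 v \<tau>"
  using theta3_plus_pi[of "v - of_real pi" \<tau>] by simp

lemma theta1_minus: "theta1 (-v) \<tau> = - theta1 v \<tau>"
  using theta2_minus[of "v + of_real pi / 2" \<tau>] theta2_minus_pi[of "v + of_real pi / 2" \<tau>]
  by (simp add: theta1_def algebra_simps)

lemma theta1_0 [simp]: "theta1 0 \<tau> = 0"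
  using theta1_minus[of 0 \<tau>] by simp

lemma theta4_times_theta4:
  assumes "Im \<tau> > 0"
  shows "theta4 (x + y) \<tau> * theta4 (x - y) \<tau> =
           theta3 (2 * x) (2 * \<tau>) * theta3 (2 * y) (2 * \<tau>) -
           theta2 (2 * x) (2 * \<tau>) * theta2 (2 * y) (2 * \<tau>)"
  using theta3_times_theta3[OF assms, of "x - of_real pi / 2" y]
    theta3_minus_pi[of "2 * x" "2 * \<tau>"] theta2_minus_pi[of "2 * x" "2 * \<tau>"]
  by (simp add: theta4_def algebra_simps)

lemma theta1_times_theta1:
  assumes "Im \<tau> > 0"
  shows "theta1 (x + y) \<tau> * theta1 (x - y) \<tau> =
           theta3 (2 * x) (2 * \<tau>) * theta2 (2 * y) (2 * \<tau>) -
           theta2 (2 * x) (2 * \<tau>) * theta3 (2 * y) (2 * \<tau>)"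
  using theta2_times_theta2[OF assms, of "x - of_real pi / 2" y]
    theta3_minus_pi[of "2 * x" "2 * \<tau>"] theta2_minus_pi[of "2 * x" "2 * \<tau>"]
  by (simp add: theta1_def algebra_simps)

text \<open>
  Here both arguments are translated by \<open>\<pi>/4\<close>, so that only one factor on the left changes.
\<close>

lemma theta1_times_theta2:
  assumes "Im \<tau> > 0"
  shows "theta1 (x + y) \<tau> * theta2 (x - y) \<tau> =
           theta4 (2 * x) (2 * \<tau>) * theta1 (2 * y) (2 * \<tau>) +
           theta1 (2 * x) (2 * \<tau>) * theta4 (2 * y) (2 * \<tau>)"
  using theta2_times_theta2[OF assms, of "x - of_real pi / 4" "y - of_real pi / 4"]
  by (simp add: theta1_def theta4_def algebra_simps)

lemma theta4_times_theta3:
  assumes "Im \<tau> > 0"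
  shows "theta4 (x + y) \<tau> * theta3 (x - y) \<tau> =
           theta4 (2 * x) (2 * \<tau>) * theta4 (2 * y) (2 * \<tau>) +
           theta1 (2 * x) (2 * \<tau>) * theta1 (2 * y) (2 * \<tau>)"
  using theta3_times_theta3[OF assms, of "x - of_real pi / 4" "y - of_real pi / 4"]
  by (simp add: theta1_def theta4_def algebra_simps)

text \<open>
  Landen's transformation from \<open>\<tau>\<close> to \<open>2\<tau>\<close>, in three instances.
\<close>

lemma theta1_landen:
  assumes "Im \<tau> > 0"
  shows "theta1 x \<tau> * theta2 x \<tau> = theta1 (2 * x) (2 * \<tau>) * theta4 0 (2 * \<tau>)"
  using theta1_times_theta2[OF assms, of x 0] by simp

lemma theta4_landen:
  assumes "Im \<tau> > 0"
  shows "theta4 x \<tau> * theta3 x \<tau> = theta4 (2 * x) (2 * \<tau>) * theta4 0 (2 * \<tau>)"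
  using theta4_times_theta3[OF assms, of x 0] by simp

lemma theta2_landen:
  assumes "Im \<tau> > 0"
  shows "theta2 0 \<tau> ^ 2 = 2 * theta2 0 (2 * \<tau>) * theta3 0 (2 * \<tau>)"
  using theta2_times_theta2[OF assms, of 0 0] by (simp add: power2_eq_square)

text \<open>
  All four squares are linear in the two functions \<open>\<theta>\<^sub>3(2x, 2\<tau>)\<close> and \<open>\<theta>\<^sub>2(2x, 2\<tau>)\<close>. This reduces each
  relation between squares of theta functions to a polynomial identity.
\<close>

lemma modulus_sumquares:
  assumes "Im \<tau> > 0"
  shows "theta1 x \<tau> ^ 2 = theta3 (2 * x) (2 * \<tau>) * theta2 0 (2 * \<tau>) - theta2 (2 * x) (2 * \<tau>) * theta3 0 (2 * \<tau>)"
    and "theta2 x \<tau> ^ 2 = theta3 (2 * x) (2 * \<tau>) * theta2 0 (2 * \<tau>) + theta2 (2 * x) (2 * \<tau>) * theta3 0 (2 * \<tau>)"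
    and "theta3 x \<tau> ^ 2 = theta3 (2 * x) (2 * \<tau>) * theta3 0 (2 * \<tau>) + theta2 (2 * x) (2 * \<tau>) * theta2 0 (2 * \<tau>)"
    and "theta4 x \<tau> ^ 2 = theta3 (2 * x) (2 * \<tau>) * theta3 0 (2 * \<tau>) - theta2 (2 * x) (2 * \<tau>) * theta2 0 (2 * \<tau>)"
  using theta1_times_theta1[OF assms, of x 0] theta2_times_theta2[OF assms, of x 0]
        theta3_times_theta3[OF assms, of x 0] theta4_times_theta4[OF assms, of x 0]
  by (simp_all add: power2_eq_square)

lemma theta1_add:
  assumes "Im \<tau> > 0"
  shows "theta1 (x + y) \<tau> * theta1 (x - y) \<tau> * theta4 0 \<tau> ^ 2 =
           theta1 x \<tau> ^ 2 * theta4 y \<tau> ^ 2 - theta4 x \<tau> ^ 2 * theta1 y \<tau> ^ 2"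
  unfolding modulus_sumquares[OF assms] theta1_times_theta1[OF assms] mult_zero_right by algebra

lemma theta4_add:
  assumes "Im \<tau> > 0"
  shows "theta4 (x + y) \<tau> * theta4 (x - y) \<tau> * theta4 0 \<tau> ^ 2 =
           theta4 x \<tau> ^ 2 * theta4 y \<tau> ^ 2 - theta1 x \<tau> ^ 2 * theta1 y \<tau> ^ 2"
  unfolding modulus_sumquares[OF assms] theta4_times_theta4[OF assms] mult_zero_right by algebra

lemma theta4_double:
  assumes "Im \<tau> > 0"
  shows "theta4 (2 * x) \<tau> * theta4 0 \<tau> ^ 3 = (theta4 x \<tau> ^ 2) ^ 2 - (theta1 x \<tau> ^ 2) ^ 2"
  using theta4_add[OF assms, of x x, folded mult_2]
  by (simp add: power2_eq_square power3_eq_cube mult_ac)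

text \<open>
  Both sides are, by Landen's transformation, the same multiple of \<open>\<theta>\<^sub>1(2x) \<theta>\<^sub>4(2x)\<close> at \<open>2\<tau>\<close>.
\<close>

lemma theta1_double:
  assumes "Im \<tau> > 0"
  shows "theta1 (2 * x) \<tau> * theta2 0 \<tau> * theta3 0 \<tau> * theta4 0 \<tau> =
           2 * theta1 x \<tau> * theta2 x \<tau> * theta3 x \<tau> * theta4 x \<tau>"
proof -
  have 1: "theta1 (2 * x) \<tau> * theta2 0 \<tau> = 2 * theta1 (2 * x) (2 * \<tau>) * theta4 (2 * x) (2 * \<tau>)"
    using theta1_times_theta2[OF assms, of x x, folded mult_2] by simp
  have 2: "theta4 0 \<tau> * theta3 0 \<tau> = theta4 0 (2 * \<tau>) * theta4 0 (2 * \<tau>)"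
    using theta4_landen[OF assms, of 0] by simp
  have "theta1 (2 * x) \<tau> * theta2 0 \<tau> * theta3 0 \<tau> * theta4 0 \<tau> =
           theta1 (2 * x) \<tau> * theta2 0 \<tau> * (theta4 0 \<tau> * theta3 0 \<tau>)"
    by (simp only: mult_ac)
  also have "\<dots> = 2 * (theta1 (2 * x) (2 * \<tau>) * theta4 0 (2 * \<tau>)) *
               (theta4 (2 * x) (2 * \<tau>) * theta4 0 (2 * \<tau>))"
    unfolding 1 2 by (simp only: mult_ac)
  also have "\<dots> = 2 * (theta1 x \<tau> * theta2 x \<tau>) * (theta4 x \<tau> * theta3 x \<tau>)"
    by (simp only: theta1_landen[OF assms] theta4_landen[OF assms])
  also have "\<dots> = 2 * theta1 x \<tau> * theta2 x \<tau> * theta3 x \<tau> * theta4 x \<tau>"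
    by (simp only: mult_ac)
  finally show ?thesis .
qed

lemma theta2_linear_relation:
  assumes "Im \<tau> > 0"
  shows "theta4 0 \<tau> ^ 2 * theta2 x \<tau> ^ 2 = theta2 0 \<tau> ^ 2 * theta4 x \<tau> ^ 2 - theta3 0 \<tau> ^ 2 * theta1 x \<tau> ^ 2"
  unfolding modulus_sumquares[OF assms] mult_zero_right by algebra

lemma theta3_linear_relation:
  assumes "Im \<tau> > 0"
  shows "theta4 0 \<tau> ^ 2 * theta3 x \<tau> ^ 2 = theta3 0 \<tau> ^ 2 * theta4 x \<tau> ^ 2 - theta2 0 \<tau> ^ 2 * theta1 x \<tau> ^ 2"
  unfolding modulus_sumquares[OF assms] mult_zero_right by algebra

text \<open>
  This is \<open>k sn\<^sup>2\<close> with modulus \<open>k = \<theta>\<^sub>2(0)\<^sup>2 / \<theta>\<^sub>3(0)\<^sup>2\<close>. The factor \<open>k\<close> makes the addition formula free of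
  parameters.
\<close>

definition theta_quot :: "complex \<Rightarrow> complex \<Rightarrow> complex" where
  "theta_quot v \<tau> = theta1 v \<tau> ^ 2 / theta4 v \<tau> ^ 2"

text \<open>
  This is \<open>k + 1/k\<close>.
\<close>

definition modulus_sum :: "complex \<Rightarrow> complex" where
  "modulus_sum \<tau> = (theta3 0 \<tau> ^ 4 + theta2 0 \<tau> ^ 4) / (theta2 0 \<tau> ^ 2 * theta3 0 \<tau> ^ 2)"

lemma theta_quot_add:
  assumes "Im \<tau> > 0" and nz: "theta4 0 \<tau> \<noteq> 0" "theta4 x \<tau> \<noteq> 0" "theta4 y \<tau> \<noteq> 0"
  shows "theta_quot (x + y) \<tau> * theta_quot (x - y) \<tau> =
           ((theta_quot x \<tau> - theta_quot y \<tau>) / (1 - theta_quot x \<tau> * theta_quot y \<tau>)) ^ 2"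
proof -
  define N where "N = theta1 x \<tau> ^ 2 * theta4 y \<tau> ^ 2 - theta4 x \<tau> ^ 2 * theta1 y \<tau> ^ 2"
  define M where "M = theta4 x \<tau> ^ 2 * theta4 y \<tau> ^ 2 - theta1 x \<tau> ^ 2 * theta1 y \<tau> ^ 2"
  have "theta_quot (x + y) \<tau> * theta_quot (x - y) \<tau> = 
          ((theta1 (x + y) \<tau> * theta1 (x - y) \<tau> * theta4 0 \<tau> ^ 2) /
           (theta4 (x + y) \<tau> * theta4 (x - y) \<tau> * theta4 0 \<tau> ^ 2)) ^ 2"
    using nz by (simp add: theta_quot_def power_divide power_mult_distrib)
  also have "\<dots> = (N / M) ^ 2"
    by (simp only: theta1_add[OF assms(1)] theta4_add[OF assms(1)] N_def M_def)
  also have "N / M = (N / (theta4 x \<tau> ^ 2 * theta4 y \<tau> ^ 2)) / (M / (theta4 x \<tau> ^ 2 * theta4 y \<tau> ^ 2))"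
    using nz by simp
  also have "N / (theta4 x \<tau> ^ 2 * theta4 y \<tau> ^ 2) = theta_quot x \<tau> - theta_quot y \<tau>"
    using nz by (simp add: N_def theta_quot_def field_simps)
  also have "M / (theta4 x \<tau> ^ 2 * theta4 y \<tau> ^ 2) = 1 - theta_quot x \<tau> * theta_quot y \<tau>"
    using nz by (simp add: M_def theta_quot_def field_simps)
  finally show ?thesis .
qed

lemma theta_quot_double:
  assumes \<tau>: "Im \<tau> > 0" 
    and nz: "theta2 0 \<tau> \<noteq> 0" "theta3 0 \<tau> \<noteq> 0" "theta4 0 \<tau> \<noteq> 0" "theta4 x \<tau> \<noteq> 0"
  defines "X \<equiv> theta_quot x \<tau>"
  shows "theta_quot (2 * x) \<tau> = 4 * X * (1 - modulus_sum \<tau> * X + X ^ 2) / (1 - X ^ 2) ^ 2"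
proof -
  define a where "a = theta1 x \<tau> ^ 2"
  define b where "b = theta4 x \<tau> ^ 2"
  define k2 where "k2 = theta2 0 \<tau> ^ 2"
  define k3 where "k3 = theta3 0 \<tau> ^ 2"
  define k4 where "k4 = theta4 0 \<tau> ^ 2"
  have nz': "b \<noteq> 0" "k2 \<noteq> 0" "k3 \<noteq> 0" "k4 \<noteq> 0"
    using nz by (auto simp: b_def k2_def k3_def k4_def)
  have s: "modulus_sum \<tau> = (k3 ^ 2 + k2 ^ 2) / (k2 * k3)"
    by (simp add: modulus_sum_def k2_def k3_def flip: power_mult)
  have X: "X = a / b" by (simp add: X_def theta_quot_def a_def b_def)
  have 2: "theta2 x \<tau> ^ 2 = (k2 * b - k3 * a) / k4"
    using theta2_linear_relation[OF \<tau>, of x] nz' by (simp add: field_simps a_def b_def k2_def k3_def k4_def)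
  have 3: "theta3 x \<tau> ^ 2 = (k3 * b - k2 * a) / k4"
    using theta3_linear_relation[OF \<tau>, of x] nz' by (simp add: field_simps a_def b_def k2_def k3_def k4_def)
  have "theta1 (2 * x) \<tau> ^ 2 = (2 * theta1 x \<tau> * theta2 x \<tau> * theta3 x \<tau> * theta4 x \<tau>) ^ 2 / (k2 * k3 * k4)"
    unfolding theta1_double[OF \<tau>, symmetric] using nz
    by (simp add: k2_def k3_def k4_def power_mult_distrib field_simps)
  also have "\<dots> = 4 * a * (theta2 x \<tau> ^ 2) * (theta3 x \<tau> ^ 2) * b / (k2 * k3 * k4)"
    by (simp add: power_mult_distrib a_def b_def)
  finally have t1: "theta1 (2 * x) \<tau> ^ 2 = 4 * a * ((k2 * b - k3 * a) / k4) * ((k3 * b - k2 * a) / k4) * b / (k2 * k3 * k4)"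
    unfolding 2 3 .
  have t4: "theta4 (2 * x) \<tau> ^ 2 = (b ^ 2 - a ^ 2) ^ 2 / k4 ^ 3"
    unfolding a_def b_def theta4_double[OF \<tau>, symmetric] k4_def
    using nz by (simp add: power_mult_distrib flip: power_mult)
  have "theta_quot (2 * x) \<tau> = (4 * a * b * ((k2 * b - k3 * a) * (k3 * b - k2 * a)) / (k2 * k3)) / (b ^ 2 - a ^ 2) ^ 2"
    using nz' by (simp add: theta_quot_def t1 t4 power3_eq_cube)
  also have "\<dots> = ((4 * a * b * ((k2 * b - k3 * a) * (k3 * b - k2 * a)) / (k2 * k3)) / b ^ 4) / ((b ^ 2 - a ^ 2) ^ 2 / b ^ 4)"
    using nz' by simp
  also have "(4 * a * b * ((k2 * b - k3 * a) * (k3 * b - k2 * a)) / (k2 * k3)) / b ^ 4 = 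
              4 * X * (1 - modulus_sum \<tau> * X + X ^ 2)"
  proof -
    have "1 - modulus_sum \<tau> * X + X ^ 2 = ((k2 * b - k3 * a) * (k3 * b - k2 * a)) / (k2 * k3 * b ^ 2)"
      using nz' unfolding X s by (simp add: divide_simps) algebra
    thus ?thesis
      using nz' unfolding X by (simp add: divide_simps eval_nat_numeral)
  qed
  also have "(b ^ 2 - a ^ 2) ^ 2 / b ^ 4 = (1 - X ^ 2) ^ 2"
  proof -
    have "1 - X ^ 2 = (b ^ 2 - a ^ 2) / b ^ 2"
      using nz' by (simp add: X field_simps)
    thus ?thesis by (simp add: power_divide flip: power_mult)
  qed
  finally show ?thesis .
qed

section \<open>Jacobi's derivative formula near the cusp\<close>

text \<open>
  The filter of \<open>\<tau> \<rightarrow> \<i>\<infinity>\<close>, formulated through the nome so that limits become values at nome 0 and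
  \<open>eventually\<close> means: for all \<open>\<tau>\<close> of sufficiently small nome.
\<close>

definition cusp :: "complex filter" where
  "cusp = filtercomap nome (nhds 0)"

lemma nome_scale: "nome (of_nat n * \<tau>) = nome \<tau> ^ n"
  by (simp add: nome_def mult_ac flip: exp_of_nat_mult)

lemma eventually_cusp: "eventually P cusp \<longleftrightarrow> (\<exists>\<epsilon>>0. \<forall>\<tau>. norm (nome \<tau>) < \<epsilon> \<longrightarrow> P \<tau>)"
  unfolding cusp_def eventually_filtercomap eventually_nhds_metric
  by (auto simp: dist_norm)

lemma eventually_cusp_Im_pos: "eventually (\<lambda>\<tau>. Im \<tau> > 0) cusp"
  unfolding eventually_cusp by (rule exI[of _ 1]) (simp add: norm_nome_less_1_iff)

lemma filterlim_nome_cusp: "filterlim nome (nhds 0) cusp"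
  unfolding cusp_def by (rule filterlim_filtercomap)

lemma filterlim_cusp_scale:
  assumes "n > 0"
  shows "filterlim (\<lambda>\<tau>. of_nat n * \<tau>) cusp cusp"
proof -
  have "((\<lambda>\<tau>. nome \<tau> ^ n) \<longlongrightarrow> 0 ^ n) cusp"
    by (intro tendsto_power filterlim_nome_cusp)
  hence "((\<lambda>\<tau>. nome (of_nat n * \<tau>)) \<longlongrightarrow> 0) cusp"
    using assms by (simp add: nome_scale power_0_left)
  thus ?thesis
    unfolding cusp_def by (simp add: filterlim_filtercomap_iff o_def cusp_def)
qed

lemma theta_nome_tendsto:
  shows "(theta3_nome v \<longlongrightarrow> 1) (nhds 0)"
    and "(theta2_nome v \<longlongrightarrow> 2 * cos v) (nhds 0)"
    and "(theta2_nome_deriv v \<longlongrightarrow> - 2 * sin v) (nhds 0)"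
proof -
  have *: "(f \<longlongrightarrow> f 0) (nhds 0)" if "f holomorphic_on ball 0 1" for f :: "complex \<Rightarrow> complex"
  proof -
    have "isCont f 0"
      using holomorphic_on_imp_continuous_on[OF that] by (simp add: continuous_on_eq_continuous_at)
    thus ?thesis by (simp add: continuous_within tendsto_at_iff_tendsto_nhds)
  qed
  show "(theta3_nome v \<longlongrightarrow> 1) (nhds 0)"
    and "(theta2_nome v \<longlongrightarrow> 2 * cos v) (nhds 0)"
    and "(theta2_nome_deriv v \<longlongrightarrow> - 2 * sin v) (nhds 0)"
    using *[OF holomorphic_theta_nome(1), of v] *[OF holomorphic_theta_nome(2), of v]
      *[OF holomorphic_theta_nome(3), of v]
    by (simp_all add: theta_nome_at_0)
qed

lemma theta3_tendsto_cusp: "(theta3 v \<longlongrightarrow> 1) cusp"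
  unfolding theta3_conv_nome[abs_def]
  by (rule filterlim_compose[OF theta_nome_tendsto(1) filterlim_nome_cusp])

lemma theta2_nome_tendsto_cusp: "((\<lambda>\<tau>. theta2_nome v (nome \<tau>)) \<longlongrightarrow> 2 * cos v) cusp"
  by (rule filterlim_compose[OF theta_nome_tendsto(2) filterlim_nome_cusp])

lemma eventually_theta3_nonzero: "eventually (\<lambda>\<tau>. theta3 v \<tau> \<noteq> 0) cusp"
  using theta3_tendsto_cusp by (rule tendsto_imp_eventually_ne) auto

lemma eventually_theta2_nonzero:
  assumes "cos v \<noteq> 0"
  shows "eventually (\<lambda>\<tau>. theta2 v \<tau> \<noteq> 0) cusp"
proof -
  have "eventually (\<lambda>\<tau>. theta2_nome v (nome \<tau>) \<noteq> 0) cusp"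
    using theta2_nome_tendsto_cusp by (rule tendsto_imp_eventually_ne) (use assms in auto)
  thus ?thesis by eventually_elim (simp add: theta2_conv_nome)
qed

definition theta1_deriv :: "complex \<Rightarrow> complex" where
  "theta1_deriv \<tau> = q_pow \<tau> (1/4) * theta2_nome_deriv (- of_real pi / 2) (nome \<tau>)"

lemma theta2_has_deriv:
  assumes "Im \<tau> > 0"
  shows "((\<lambda>v. theta2 v \<tau>) has_field_derivative q_pow \<tau> (1/4) * theta2_nome_deriv v (nome \<tau>)) (at v)"
  unfolding theta2_conv_nome
  by (intro DERIV_cmult theta2_nome_has_deriv norm_nome_less_1 assms)

lemma theta1_has_deriv:
  assumes "Im \<tau> > 0"
  shows "((\<lambda>v. theta1 v \<tau>) has_field_derivative theta1_deriv \<tau>) (at 0)"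
proof -
  have "((\<lambda>v. theta2 v \<tau>) has_field_derivative theta1_deriv \<tau>) (at (0 + (- of_real pi / 2)))"
    using theta2_has_deriv[OF assms, of "- of_real pi / 2"] by (simp add: theta1_deriv_def)
  thus ?thesis
    unfolding DERIV_shift by (simp add: theta1_def)
qed

lemma theta1_deriv_landen:
  assumes \<tau>: "Im \<tau> > 0"
  shows "theta1_deriv \<tau> * theta2 0 \<tau> = 2 * theta1_deriv (2 * \<tau>) * theta4 0 (2 * \<tau>)"
proof (rule DERIV_unique)
  show "((\<lambda>x. theta1 x \<tau> * theta2 x \<tau>) has_field_derivative theta1_deriv \<tau> * theta2 0 \<tau>) (at 0)"
    using DERIV_mult[OF theta1_has_deriv[OF \<tau>] theta2_has_deriv[OF \<tau>]] by (simp add: mult.commute)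
  have "((\<lambda>x. theta1 (2 * x) (2 * \<tau>)) has_field_derivative theta1_deriv (2 * \<tau>) * 2) (at 0)"
    by (rule DERIV_chain2[where g = "\<lambda>x. 2 * x"])
       (use theta1_has_deriv[of "2 * \<tau>"] \<tau> in \<open>auto intro!: derivative_eq_intros\<close>)
  from DERIV_cmult_right[OF this, of "theta4 0 (2 * \<tau>)"]
  show "((\<lambda>x. theta1 x \<tau> * theta2 x \<tau>) has_field_derivative 2 * theta1_deriv (2 * \<tau>) * theta4 0 (2 * \<tau>)) (at 0)"
    unfolding theta1_landen[OF \<tau>] by (simp add: mult_ac)
qed

text \<open>
  The quotient \<open>R\<close> of the two sides takes the same value at \<open>\<tau>\<close> and \<open>2\<tau>\<close>: this is Landen's
  transformation, differentiated at 0. Hence \<open>R(\<tau>) = R(2\<^sup>n \<tau>)\<close>, and the right-hand side tends to the limit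
  of \<open>R\<close> at the cusp, which is read off from the leading terms as 1.
\<close>

lemma jacobi_derivative_near_cusp:
  "eventually (\<lambda>\<tau>. theta1_deriv \<tau> = theta2 0 \<tau> * theta3 0 \<tau> * theta4 0 \<tau>) cusp"
proof -
  define R where "R = (\<lambda>\<tau>. theta1_deriv \<tau> / (theta2 0 \<tau> * theta3 0 \<tau> * theta4 0 \<tau>))"
  have "((\<lambda>\<tau>. theta2_nome_deriv (- of_real pi / 2) (nome \<tau>) / 
            (theta2_nome 0 (nome \<tau>) * theta3 0 \<tau> * theta4 0 \<tau>)) \<longlongrightarrow>
          (- 2 * sin (- of_real pi / 2)) / (2 * cos 0 * 1 * 1)) cusp"
    unfolding theta4_def
    by (intro tendsto_divide tendsto_mult theta3_tendsto_cusp theta2_nome_tendsto_cusp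
          filterlim_compose[OF theta_nome_tendsto(3) filterlim_nome_cusp]) auto
  also have "(- 2 * sin (- of_real pi / 2)) / (2 * cos 0 * 1 * 1) = (1 :: complex)"
    using sin_of_real[of "pi / 2"] by (simp del: sin_of_real)
  also have "(\<lambda>\<tau>. theta2_nome_deriv (- of_real pi / 2) (nome \<tau>) / 
            (theta2_nome 0 (nome \<tau>) * theta3 0 \<tau> * theta4 0 \<tau>)) = R"
    by (simp add: R_def theta1_deriv_def theta2_conv_nome fun_eq_iff)
  finally have R_lim: "(R \<longlongrightarrow> 1) cusp" .

  have "eventually (\<lambda>\<tau>. theta2 0 \<tau> \<noteq> 0) cusp"
    by (rule eventually_theta2_nonzero) auto
  moreover have "eventually (\<lambda>\<tau>. theta3 0 \<tau> \<noteq> 0) cusp"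
    by (rule eventually_theta3_nonzero)
  moreover have "eventually (\<lambda>\<tau>. theta4 0 \<tau> \<noteq> 0) cusp"
    unfolding theta4_def by (rule eventually_theta3_nonzero)
  ultimately have "eventually (\<lambda>\<tau>. Im \<tau> > 0 \<and> theta2 0 \<tau> \<noteq> 0 \<and> theta3 0 \<tau> \<noteq> 0 \<and> theta4 0 \<tau> \<noteq> 0) cusp"
    using eventually_cusp_Im_pos by eventually_elim auto
  then obtain \<epsilon> where \<epsilon>: "\<epsilon> > 0" and
    nz: "\<And>\<tau>. norm (nome \<tau>) < \<epsilon> \<Longrightarrow> Im \<tau> > 0 \<and> theta2 0 \<tau> \<noteq> 0 \<and> theta3 0 \<tau> \<noteq> 0 \<and> theta4 0 \<tau> \<noteq> 0"
    unfolding eventually_cusp by blast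
  have small: "norm (nome (of_nat n * \<tau>)) < \<epsilon>" if "norm (nome \<tau>) < \<epsilon>" "n > 0" for n \<tau>
  proof -
    have "norm (nome \<tau>) ^ n \<le> norm (nome \<tau>)"
      using that nz[of \<tau>] norm_nome_less_1[of \<tau>] by (intro power_le_one_iff[THEN iffD2] power_decreasing[of 1 n, simplified]) auto
    thus ?thesis using that by (simp add: nome_scale norm_power)
  qed
  have R_double: "R \<tau> = R (2 * \<tau>)" if "norm (nome \<tau>) < \<epsilon>" for \<tau>
  proof -
    note nz1 = nz[OF that] and nz2 = nz[OF small[OF that, of 2, simplified]]
    have "R \<tau> = (theta1_deriv \<tau> * theta2 0 \<tau>) / (theta2 0 \<tau> ^ 2 * (theta4 0 \<tau> * theta3 0 \<tau>))"
      using nz1 by (simp add: R_def power2_eq_square)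
    also have "theta4 0 \<tau> * theta3 0 \<tau> = theta4 0 (2 * \<tau>) * theta4 0 (2 * \<tau>)"
      using theta4_landen[of \<tau> 0] nz1 by simp
    also have "(theta1_deriv \<tau> * theta2 0 \<tau>) / (theta2 0 \<tau> ^ 2 * (theta4 0 (2 * \<tau>) * theta4 0 (2 * \<tau>))) = R (2 * \<tau>)"
      using nz1 nz2 by (simp add: R_def theta1_deriv_landen theta2_landen)
    finally show ?thesis .
  qed
  have "R \<tau> = 1" if "norm (nome \<tau>) < \<epsilon>" for \<tau>
  proof -
    have R: "R (of_nat (2 ^ n) * \<tau>) = R \<tau>" for n
    proof (induction n)
      case (Suc n)
      have "R (of_nat (2 ^ n) * \<tau>) = R (2 * (of_nat (2 ^ n) * \<tau>))"
        by (rule R_double, rule small) (use that in auto)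
      thus ?case using Suc by (simp add: mult_ac)
    qed auto
    have "filterlim (\<lambda>n. of_nat (2 ^ n) * \<tau>) cusp sequentially"
    proof -
      have "filterlim (\<lambda>n::nat. (2::nat) ^ n) at_top sequentially"
        by (intro filterlim_subseq strict_monoI power_strict_increasing) auto
      moreover have "(\<lambda>n. nome \<tau> ^ n) \<longlonglongrightarrow> 0"
        using that nz norm_nome_less_1 by (intro LIMSEQ_power_zero) auto
      ultimately have "(\<lambda>n. nome \<tau> ^ (2 ^ n)) \<longlonglongrightarrow> 0"
        by (rule filterlim_compose[rotated])
      thus ?thesis unfolding cusp_def filterlim_filtercomap_iff o_def nome_scale .
    qed
    hence "(\<lambda>n. R (of_nat (2 ^ n) * \<tau>)) \<longlonglongrightarrow> 1"
      by (rule filterlim_compose[OF R_lim])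
    thus ?thesis unfolding R by (simp add: LIMSEQ_const_iff)
  qed
  thus ?thesis
    unfolding eventually_cusp using \<epsilon> nz by (intro exI[of _ \<epsilon>]) (auto simp: R_def divide_simps split: if_splits)
qed

section \<open>Products of translates\<close>

text \<open>
  The value of the sum of the norms is known as a product of nonzero numbers. A family that is not
  summable would have sum 0 by convention, so the norms are summable.
\<close>

lemma summable_on_prod_PiE:
  fixes f :: "'a \<Rightarrow> 'b \<Rightarrow> complex"
  assumes "finite A" and sum: "\<And>x. x \<in> A \<Longrightarrow> (\<lambda>y. norm (f x y)) summable_on B x"
    and nz: "\<And>x y. f x y \<noteq> 0" and ne: "\<And>x. x \<in> A \<Longrightarrow> B x \<noteq> {}"
  shows "(\<lambda>g. \<Prod>x\<in>A. f x (g x)) summable_on PiE A B"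
proof -
  have pos: "infsum (\<lambda>y. norm (f x y)) (B x) \<noteq> 0" if "x \<in> A" for x
    using nonneg_infsum_le_0D[of "\<lambda>y. norm (f x y)" "B x"] sum[OF that] ne[OF that] nz
    by fastforce
  have "infsum (\<lambda>g. \<Prod>x\<in>A. norm (f x (g x))) (PiE A B) = (\<Prod>x\<in>A. infsum (\<lambda>y. norm (f x y)) (B x))"
    using assms by (intro infsum_prod_PiE_abs) auto
  also have "\<dots> \<noteq> 0" using pos \<open>finite A\<close> by simp
  finally have "(\<lambda>g. \<Prod>x\<in>A. norm (f x (g x))) summable_on PiE A B"
    using infsum_not_exists by blast
  hence "(\<lambda>g. norm (\<Prod>x\<in>A. f x (g x))) summable_on PiE A B"
    by (simp add: prod_norm)
  thus ?thesis by (rule Infinite_Sum.abs_summable_summable)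
qed

text \<open>
  Multiplied out, the product is a sum over \<open>m \<in> \<int>\<^sup>N\<close>; collecting the terms with given \<open>n = \<Sum> m\<^sub>k\<close> gives a
  series \<open>\<Sum> g n e\<^sup>2\<^sup>i\<^sup>n\<^sup>v\<close>. Rotating \<open>m\<close> cyclically multiplies the terms by a root of unity of exponent \<open>n\<close>,
  whence \<open>g n = 0\<close> unless \<open>N\<close> divides \<open>n\<close>. Adding 1 to all \<open>m\<^sub>k\<close> gives a recursion from \<open>g n\<close> to \<open>g (n + N)\<close>
  that determines the remaining coefficients up to the factor \<open>C = g 0\<close>; it is the recursion satisfied
  by the coefficients of \<open>\<theta>\<^sub>3(N v, N \<tau>)\<close>. For even \<open>N\<close> the product of all \<open>N\<close>-th roots of unity is \<open>- 1\<close>,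
  which would change the sign in the recursion.
\<close>

lemma theta3_product:
  assumes \<tau>: "Im \<tau> > 0" and N: "odd N"
  obtains C where "\<And>v. (\<Prod>k<N. theta3 (v + of_nat k * of_real pi / of_nat N) \<tau>) =
                        C * theta3 (of_nat N * v) (of_nat N * \<tau>)"
proof -
  define P where "P = PiE {..<N} (\<lambda>_. UNIV :: int set)"
  define S where "S = (\<lambda>n. {m\<in>P. (\<Sum>k<N. m k) = n})"
  define \<zeta> where "\<zeta> = (\<lambda>j::int. exp (2 * of_real pi * \<i> * of_int j / of_nat N))"
  define W where "W = (\<lambda>m. \<Prod>k<N. q_pow \<tau> (of_int (m k) ^ 2) * \<zeta> (m k * int k))"
  define g where "g = (\<lambda>n. \<Sum>\<^sub>\<infinity>m\<in>S n. W m)"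
  have N0: "N > 0" using N by (cases N) auto
  have \<zeta>_add: "\<zeta> (a + b) = \<zeta> a * \<zeta> b" for a b
    by (simp add: \<zeta>_def ring_distribs add_divide_distrib exp_add)
  have \<zeta>_eq_1: "\<zeta> a = 1 \<longleftrightarrow> int N dvd a" for a
  proof -
    have "\<zeta> a = 1 \<longleftrightarrow> (\<exists>j::int. 2 * pi * of_int a / of_nat N = of_int (2 * j) * pi)"
      by (simp add: \<zeta>_def exp_eq_1)
    also have "\<dots> \<longleftrightarrow> (\<exists>j::int. a = int N * j)"
    proof -
      have "2 * pi * of_int a / of_nat N = of_int (2 * j) * pi \<longleftrightarrow> a = int N * j" for j :: int
      proof -
        have "2 * pi * of_int a / of_nat N = of_int (2 * j) * pi \<longleftrightarrow>
                 real_of_int a = real_of_int (int N * j)"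
          using N0 by (auto simp: field_simps)
        thus ?thesis by (simp only: of_int_eq_iff)
      qed
      thus ?thesis by simp
    qed
    finally show ?thesis by (simp add: dvd_def)
  qed
  have \<zeta>_cong: "\<zeta> a = \<zeta> b" if "int N dvd a - b" for a b
    using that \<zeta>_eq_1[of "a - b"] \<zeta>_add[of "a - b" b] by simp
  have \<zeta>_sum: "\<zeta> (sum f A) = (\<Prod>x\<in>A. \<zeta> (f x))" for f :: "nat \<Rightarrow> int" and A
    by (induction A rule: infinite_finite_induct) (auto simp: \<zeta>_add, auto simp: \<zeta>_def)
  have q_sum: "q_pow \<tau> (sum f A) = (\<Prod>x\<in>A. q_pow \<tau> (f x))" for f :: "nat \<Rightarrow> real" and A
    by (induction A rule: infinite_finite_induct)
       (auto simp: q_pow_def ring_distribs exp_add)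

  \<comment> \<open>The variable \<open>v\<close> enters a term only through the sum \<open>n\<close>.\<close>
  have T: "(\<Prod>k<N. q_pow \<tau> (of_int (m k) ^ 2) *
             exp (2 * of_int (m k) * \<i> * (v + of_nat k * of_real pi / of_nat N))) =
           W m * exp (2 * of_int n * \<i> * v)" if "(\<Sum>k<N. m k) = n" for v m n
  proof -
    have "exp (2 * of_int n * \<i> * v) = (\<Prod>k<N. exp (2 * of_int (m k) * \<i> * v))"
      unfolding that[symmetric]
      by (simp add: sum_distrib_left sum_distrib_right flip: exp_sum)
    thus ?thesis unfolding W_def
      by (simp add: \<zeta>_def ring_distribs exp_add mult_ac flip: prod.distrib)
  qed

  \<comment> \<open>The cyclic rotation of the indices and its inverse.\<close>
  define r where "r = (\<lambda>k. (k + 1) mod N)"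
  define l where "l = (\<lambda>k. (k + (N - 1)) mod N)"
  have r_l: "r (l k) = k" if "k < N" for k
    unfolding r_def l_def using that N0 by (subst mod_add_left_eq) simp
  have l_r: "l (r k) = k" if "k < N" for k
    unfolding r_def l_def using that N0 by (subst mod_add_left_eq) simp
  have lt: "r k < N" "l k < N" for k
    using N0 by (auto simp: r_def l_def)
  have rot_sum: "(\<Sum>k<N. f (r k)) = (\<Sum>k<N. f k)" for f :: "nat \<Rightarrow> int"
    by (rule sum.reindex_bij_witness[of _ "\<lambda>k. l k" "\<lambda>k. r k"])
       (use l_r r_l lt in auto)
  have rot_prod: "(\<Prod>k<N. f (r k)) = (\<Prod>k<N. f k)" for f :: "nat \<Rightarrow> complex"
    by (rule prod.reindex_bij_witness[of _ "\<lambda>k. l k" "\<lambda>k. r k"])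
       (use l_r r_l lt in auto)

  have cyclic: "g n = \<zeta> (-n) * g n" for n
  proof -
    have "g n = (\<Sum>\<^sub>\<infinity>m\<in>S n. \<zeta> (-n) * W m)"
      unfolding g_def
    proof (rule infsum_reindex_bij_witness[symmetric, of _
            "\<lambda>m. \<lambda>k\<in>{..<N}. m (l k)" "\<lambda>m. \<lambda>k\<in>{..<N}. m (r k)"], goal_cases)
      case (1 m)
      thus ?case using lt l_r r_l by (auto simp: S_def P_def PiE_def extensional_def fun_eq_iff)
    next
      case (2 m)
      thus ?case using rot_sum[of m] by (auto simp: S_def P_def)
    next
      case (3 m)
      thus ?case using lt l_r r_l by (auto simp: S_def P_def PiE_def extensional_def fun_eq_iff)
    next
      case (4 m)
      have "(\<Sum>k<N. m (l k)) = (\<Sum>k<N. m k)"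
        using rot_sum[of "\<lambda>k. m (l k)"] l_r by simp
      thus ?case using 4 by (auto simp: S_def P_def)
    next
      case (5 m)
      have "W (\<lambda>k\<in>{..<N}. m (r k)) =
              (\<Prod>k<N. q_pow \<tau> (of_int (m (r k)) ^ 2) * \<zeta> (m (r k) * (int (r k) - 1)))"
        unfolding W_def
      proof (rule prod.cong)
        fix k assume "k \<in> {..<N}"
        have "int N dvd int k - (int (r k) - 1)"
        proof -
          have "int N dvd int (k + 1) - int (k + 1) mod int N"
            by (rule dvd_minus_mod)
          thus ?thesis by (simp add: r_def zmod_int algebra_simps)
        qed
        hence "int N dvd m (r k) * (int k - (int (r k) - 1))"
          by (rule dvd_mult)
        hence "\<zeta> (m (r k) * int k) = \<zeta> (m (r k) * (int (r k) - 1))"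
          by (intro \<zeta>_cong) (simp add: algebra_simps)
        thus "q_pow \<tau> (of_int ((\<lambda>k\<in>{..<N}. m (r k)) k) ^ 2) * \<zeta> ((\<lambda>k\<in>{..<N}. m (r k)) k * int k) =
              q_pow \<tau> (of_int (m (r k)) ^ 2) * \<zeta> (m (r k) * (int (r k) - 1))"
          using \<open>k \<in> {..<N}\<close> by simp
      qed auto
      also have "\<dots> = (\<Prod>k<N. q_pow \<tau> (of_int (m k) ^ 2) * \<zeta> (m k * (int k - 1)))"
        by (rule rot_prod)
      also have "\<dots> = (\<Prod>k<N. \<zeta> (- m k)) * W m"
        unfolding W_def prod.distrib[symmetric]
        by (intro prod.cong refl) (simp add: right_diff_distrib mult_ac flip: \<zeta>_add)
      also have "(\<Prod>k<N. \<zeta> (- m k)) = \<zeta> (- n)"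
        using 5 by (simp add: S_def sum_negf flip: \<zeta>_sum)
      finally show ?case .
    qed
    thus ?thesis by (simp add: g_def infsum_cmult_right')
  qed

  have shift: "g (n + int N) = q_pow \<tau> (of_int (2 * n + int N)) * g n" for n
  proof -
    have "g (n + int N) = (\<Sum>\<^sub>\<infinity>m\<in>S n. q_pow \<tau> (of_int (2 * n + int N)) * W m)"
      unfolding g_def
    proof (rule infsum_reindex_bij_witness[symmetric, of _
            "\<lambda>m. \<lambda>k\<in>{..<N}. m k - 1" "\<lambda>m. \<lambda>k\<in>{..<N}. m k + 1"], goal_cases)
      case (5 m)
      have "(\<Prod>k<N. \<zeta> (int k)) = \<zeta> (\<Sum>k<N. int k)"
        by (rule \<zeta>_sum[symmetric])
      also have "\<dots> = 1"
      proof -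
        obtain M where M: "N = 2 * M + 1" using N by (elim oddE)
        have "(\<Sum>k<2 * M + 1. int k) = int (2 * M + 1) * int M"
          by (induction M) (auto simp: algebra_simps)
        thus ?thesis unfolding \<zeta>_eq_1 M by simp
      qed
      finally have z: "(\<Prod>k<N. \<zeta> (int k)) = 1" .
      have "W (\<lambda>k\<in>{..<N}. m k + 1) = (\<Prod>k<N. q_pow \<tau> (of_int (2 * m k + 1)) * \<zeta> (int k) *
               (q_pow \<tau> (of_int (m k) ^ 2) * \<zeta> (m k * int k)))"
        unfolding W_def
      proof (intro prod.cong refl)
        fix k assume "k \<in> {..<N}"
        have "q_pow \<tau> (of_int (m k + 1) ^ 2) = q_pow \<tau> (of_int (2 * m k + 1)) * q_pow \<tau> (of_int (m k) ^ 2)"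
          by (simp add: q_pow_def power2_eq_square algebra_simps flip: exp_add)
        thus "q_pow \<tau> (of_int ((\<lambda>k\<in>{..<N}. m k + 1) k) ^ 2) * \<zeta> ((\<lambda>k\<in>{..<N}. m k + 1) k * int k) =
          q_pow \<tau> (of_int (2 * m k + 1)) * \<zeta> (int k) * (q_pow \<tau> (of_int (m k) ^ 2) * \<zeta> (m k * int k))"
          using \<open>k \<in> {..<N}\<close> by (simp add: distrib_left \<zeta>_add mult_ac)
      qed
      also have "\<dots> = (\<Prod>k<N. q_pow \<tau> (of_int (2 * m k + 1))) * W m"
        unfolding prod.distrib W_def z by simp
      also have "(\<Prod>k<N. q_pow \<tau> (of_int (2 * m k + 1))) = q_pow \<tau> (of_int (2 * n + int N))"
      proof -
        have "of_int (2 * n + int N) = (\<Sum>k<N. real_of_int (2 * m k + 1))"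
          using 5 by (simp add: S_def sum.distrib sum_distrib_left[symmetric] flip: of_int_sum)
        thus ?thesis by (simp only: q_sum)
      qed
      finally show ?case .
    qed (auto simp: S_def P_def sum.distrib sum_subtractf PiE_def extensional_def fun_eq_iff)
    thus ?thesis by (simp add: g_def infsum_cmult_right')
  qed

  have g: "g (int N * j) = g 0 * q_pow (of_nat N * \<tau>) (of_int j ^ 2)" for j
  proof (induction j rule: int_induct[where k = 0])
    case (step1 j)
    have "q_pow \<tau> (of_int (2 * (int N * j) + int N)) * q_pow (of_nat N * \<tau>) (of_int j ^ 2) =
            q_pow (of_nat N * \<tau>) (of_int (j + 1) ^ 2)"
      by (simp add: q_pow_def power2_eq_square algebra_simps flip: exp_add)
    thus ?case using shift[of "int N * j"] step1 by (simp add: algebra_simps)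
  next
    case (step2 j)
    have "q_pow \<tau> (of_int (2 * (int N * (j - 1)) + int N)) * q_pow (of_nat N * \<tau>) (of_int (j - 1) ^ 2) =
            q_pow (of_nat N * \<tau>) (of_int j ^ 2)"
      by (simp add: q_pow_def power2_eq_square algebra_simps flip: exp_add)
    moreover have "q_pow \<tau> (of_int (2 * (int N * (j - 1)) + int N)) * g (int N * (j - 1)) =
            g 0 * q_pow (of_nat N * \<tau>) (of_int j ^ 2)"
      using shift[of "int N * (j - 1)"] step2 by (simp add: algebra_simps)
    ultimately have "q_pow \<tau> (of_int (2 * (int N * (j - 1)) + int N)) * g (int N * (j - 1)) =
            q_pow \<tau> (of_int (2 * (int N * (j - 1)) + int N)) * (g 0 * q_pow (of_nat N * \<tau>) (of_int (j - 1) ^ 2))"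
      by (simp only: mult_ac)
    thus ?case unfolding mult_cancel_left by simp
  qed (simp add: q_pow_def)

  have "(\<Prod>k<N. theta3 (v + of_nat k * of_real pi / of_nat N) \<tau>) =
          g 0 * theta3 (of_nat N * v) (of_nat N * \<tau>)" for v
  proof -
    define f where "f = (\<lambda>k (m::int). q_pow \<tau> (of_int m ^ 2) *
             exp (2 * of_int m * \<i> * (v + of_nat k * of_real pi / of_nat N)))"
    have sum_f: "(\<lambda>m. norm (f k m)) summable_on UNIV" for k
      unfolding f_def by (rule theta3_abs_summable[OF \<tau>])
    have sum_P: "(\<lambda>m. \<Prod>k<N. f k (m k)) summable_on P"
      unfolding P_def by (rule summable_on_prod_PiE) (use sum_f in \<open>auto simp: f_def\<close>)
    have "(\<Prod>k<N. theta3 (v + of_nat k * of_real pi / of_nat N) \<tau>) = (\<Prod>k<N. infsum (f k) UNIV)"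
      by (simp add: theta3_def f_def)
    also have "\<dots> = (\<Sum>\<^sub>\<infinity>m\<in>P. \<Prod>k<N. f k (m k))"
      unfolding P_def by (rule infsum_prod_PiE_abs[symmetric]) (use sum_f in auto)
    also have "\<dots> = (\<Sum>\<^sub>\<infinity>(n, m)\<in>Sigma UNIV S. \<Prod>k<N. f k (m k))"
      by (rule infsum_reindex_bij_witness[of _ snd "\<lambda>m. (\<Sum>k<N. m k, m)"]) (auto simp: S_def)
    also have "\<dots> = (\<Sum>\<^sub>\<infinity>n. \<Sum>\<^sub>\<infinity>m\<in>S n. \<Prod>k<N. f k (m k))"
    proof (rule infsum_Sigma'_banach[symmetric])
      show "(\<lambda>(n, m). \<Prod>k<N. f k (m k)) summable_on Sigma UNIV S"
        using sum_P
        by (subst summable_on_reindex_bij_witness[of _ "\<lambda>m. (\<Sum>k<N. m k, m)" snd P]) (auto simp: S_def)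
    qed
    also have "\<dots> = (\<Sum>\<^sub>\<infinity>n. g n * exp (2 * of_int n * \<i> * v))"
    proof (rule infsum_cong)
      fix n
      have "(\<Sum>\<^sub>\<infinity>m\<in>S n. \<Prod>k<N. f k (m k)) = (\<Sum>\<^sub>\<infinity>m\<in>S n. W m * exp (2 * of_int n * \<i> * v))"
        unfolding f_def by (rule infsum_cong, rule T) (auto simp: S_def)
      thus "(\<Sum>\<^sub>\<infinity>m\<in>S n. \<Prod>k<N. f k (m k)) = g n * exp (2 * of_int n * \<i> * v)"
        by (simp add: g_def infsum_cmult_left')
    qed
    also have "\<dots> = (\<Sum>\<^sub>\<infinity>n\<in>range (\<lambda>j. int N * j). g n * exp (2 * of_int n * \<i> * v))"
    proof (rule infsum_cong_neutral)
      fix n assume "n \<in> UNIV - range (\<lambda>j. int N * j)"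
      hence "\<not> int N dvd n" by (auto simp: dvd_def)
      hence "\<zeta> (- n) \<noteq> 1" by (simp add: \<zeta>_eq_1)
      thus "g n * exp (2 * of_int n * \<i> * v) = 0" using cyclic[of n] by simp
    qed auto
    also have "\<dots> = (\<Sum>\<^sub>\<infinity>j. g (int N * j) * exp (2 * of_int (int N * j) * \<i> * v))"
      by (subst infsum_reindex) (use N0 in \<open>auto simp: inj_on_def o_def\<close>)
    also have "\<dots> = g 0 * theta3 (of_nat N * v) (of_nat N * \<tau>)"
      unfolding g theta3_def infsum_cmult_right'[symmetric]
      by (rule infsum_cong) (simp add: mult_ac)
    finally show ?thesis .
  qed
  thus ?thesis by (rule that)
qed

lemma theta1_plus_pi: "theta1 (v + of_real pi) \<tau> = - theta1 v \<tau>"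
  using theta2_plus_pi[of "v - of_real pi / 2" \<tau>] by (simp add: theta1_def algebra_simps)

lemma theta4_plus_pi: "theta4 (v + of_real pi) \<tau> = theta4 v \<tau>"
  using theta3_plus_pi[of "v - of_real pi / 2" \<tau>] by (simp add: theta4_def algebra_simps)

lemma theta4_minus: "theta4 (-v) \<tau> = theta4 v \<tau>"
  using theta3_minus[of "v + of_real pi / 2" \<tau>] theta3_minus_pi[of "v + of_real pi / 2" \<tau>]
  by (simp add: theta4_def algebra_simps)

text \<open>
  Translation by \<open>\<pi>\<tau>\<close> turns \<open>\<theta>\<^sub>3\<close> into \<open>\<theta>\<^sub>2\<close>; the resulting exponential factors on both sides agree because
  \<open>0 + 1 + 2 + 3 + 4\<close> is twice 5. So the constant is the one for \<open>\<theta>\<^sub>3\<close>.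
\<close>

lemma theta2_product5:
  assumes C: "\<And>v. (\<Prod>k<5. theta3 (v + of_nat k * of_real pi / of_nat 5) \<tau>) =
                   C * theta3 (of_nat 5 * v) (of_nat 5 * \<tau>)"
  shows "(\<Prod>k<5. theta2 (v + of_nat k * of_real pi / of_nat 5) \<tau>) =
           C * theta2 (of_nat 5 * v) (of_nat 5 * \<tau>)"
proof -
  let ?v = "\<lambda>k. v + of_nat k * of_real pi / of_nat 5 :: complex"
  have "(\<Prod>k<5. theta2 (?v k) \<tau>) =
          (\<Prod>k<5. q_pow \<tau> (1/4) * exp (\<i> * ?v k)) *
          (\<Prod>k<5. theta3 ((v + of_real pi * \<tau>) + of_nat k * of_real pi / of_nat 5) \<tau>)"
    unfolding prod.distrib[symmetric]
    by (intro prod.cong refl) (simp add: theta2_conv_theta3 add_ac)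
  also have "(\<Prod>k<5. q_pow \<tau> (1/4) * exp (\<i> * ?v k)) = q_pow (of_nat 5 * \<tau>) (1/4) * exp (\<i> * (of_nat 5 * v))"
  proof -
    have "(\<Prod>k<5. q_pow \<tau> (1/4) * exp (\<i> * ?v k)) =
            q_pow (of_nat 5 * \<tau>) (1/4) * exp (\<i> * (of_nat 5 * v) + 2 * of_real pi * \<i>)"
      by (simp add: q_pow_def eval_nat_numeral lessThan_Suc flip: exp_add) (rule arg_cong[of _ _ exp], simp add: field_simps)
    thus ?thesis by (simp add: exp_add)
  qed
  finally show ?thesis
    unfolding C by (simp add: theta2_conv_theta3 algebra_simps)
qed

text \<open>
  The translates by \<open>3\<pi>/5\<close> and \<open>4\<pi>/5\<close> are replaced by those by \<open>- 2\<pi>/5\<close> and \<open>- \<pi>/5\<close>, so that the factors form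
  the pairs to which the addition formula applies. The two signs that this produces for \<open>\<theta>\<^sub>1\<close> cancel.
\<close>

lemma theta_quintic:
  assumes \<tau>: "Im \<tau> > 0"
  obtains C where
    "\<And>v. theta1 v \<tau> * (theta1 (v + of_real (pi/5)) \<tau> * theta1 (v - of_real (pi/5)) \<tau>) *
         (theta1 (v + of_real (2*pi/5)) \<tau> * theta1 (v - of_real (2*pi/5)) \<tau>) = C * theta1 (5 * v) (5 * \<tau>)"
    "\<And>v. theta4 v \<tau> * (theta4 (v + of_real (pi/5)) \<tau> * theta4 (v - of_real (pi/5)) \<tau>) *
         (theta4 (v + of_real (2*pi/5)) \<tau> * theta4 (v - of_real (2*pi/5)) \<tau>) = C * theta4 (5 * v) (5 * \<tau>)"
proof -
  obtain C where C: "\<And>v. (\<Prod>k<5. theta3 (v + of_nat k * of_real pi / of_nat 5) \<tau>) =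
                   C * theta3 (of_nat 5 * v) (of_nat 5 * \<tau>)"
    using theta3_product[OF \<tau>, of 5] by auto
  have t1: "theta1 (5 * v) (5 * \<tau>) = theta2 (of_nat 5 * (v - of_real pi / 2)) (of_nat 5 * \<tau>)" for v
    using theta2_minus_pi[of "5 * v - of_real pi / 2" "5 * \<tau>"]
      theta2_minus_pi[of "5 * v - 3 * of_real pi / 2" "5 * \<tau>"]
    by (simp add: theta1_def algebra_simps)
  have t4: "theta4 (5 * v) (5 * \<tau>) = theta3 (of_nat 5 * (v - of_real pi / 2)) (of_nat 5 * \<tau>)" for v
    using theta3_minus_pi[of "5 * v - of_real pi / 2" "5 * \<tau>"]
      theta3_minus_pi[of "5 * v - 3 * of_real pi / 2" "5 * \<tau>"]
    by (simp add: theta4_def algebra_simps)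
  have e: "{..<5::nat} = {0,1,2,3,4}" by auto
  have p1: "(\<Prod>k<5. theta2 ((v - of_real pi / 2) + of_nat k * of_real pi / of_nat 5) \<tau>) =
     theta1 v \<tau> * (theta1 (v + of_real (pi/5)) \<tau> * theta1 (v - of_real (pi/5)) \<tau>) *
         (theta1 (v + of_real (2*pi/5)) \<tau> * theta1 (v - of_real (2*pi/5)) \<tau>)" for v
    using theta1_plus_pi[of "v - of_real (pi/5)" \<tau>] theta1_plus_pi[of "v - of_real (2*pi/5)" \<tau>]
    by (simp add: e theta1_def algebra_simps)
  have p4: "(\<Prod>k<5. theta3 ((v - of_real pi / 2) + of_nat k * of_real pi / of_nat 5) \<tau>) =
     theta4 v \<tau> * (theta4 (v + of_real (pi/5)) \<tau> * theta4 (v - of_real (pi/5)) \<tau>) *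
         (theta4 (v + of_real (2*pi/5)) \<tau> * theta4 (v - of_real (2*pi/5)) \<tau>)" for v
    using theta4_plus_pi[of "v - of_real (pi/5)" \<tau>] theta4_plus_pi[of "v - of_real (2*pi/5)" \<tau>]
    by (simp add: e theta4_def algebra_simps)
  show ?thesis
  proof (rule that[of C], goal_cases)
    case (1 v)
    show ?case unfolding p1[symmetric] t1 by (rule theta2_product5[OF C])
  next
    case (2 v)
    show ?case unfolding p4[symmetric] t4 by (rule C)
  qed
qed

section \<open>Commutation of quintic transformation and duplication\<close>

definition quintic_map :: "complex \<Rightarrow> complex \<Rightarrow> complex \<Rightarrow> complex" where
  "quintic_map a b X = X * ((X - a) / (1 - X * a) * ((X - b) / (1 - X * b))) ^ 2"

definition double_map :: "complex \<Rightarrow> complex \<Rightarrow> complex" where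
  "double_map s X = 4 * X * (1 - s * X + X ^ 2) / (1 - X ^ 2) ^ 2"

text \<open>
  The two compositions agree along values \<open>X v\<close> that tend to 0 without vanishing, so their power series at
  0 coincide. Dividing both sides by \<open>X\<close> leaves functions \<open>d\<close> and \<open>\<phi>\<close> that do not vanish at 0, and the
  second coefficient becomes a first derivative: that of \<open>g\<close>, which must be 0.
\<close>

lemma quintic_double_coefficient:
  fixes X :: "'a \<Rightarrow> complex"
  assumes F: "F \<noteq> bot" and X: "filterlim X (at 0) F"
    and eq: "eventually (\<lambda>v. quintic_map a b (double_map s (X v)) = double_map s' (quintic_map a b (X v))) F"
    and nz: "a * b \<noteq> 0"
  shows "6 * (a + b) * (a * b - 1) = a * b * (s - s' * (a * b) ^ 2)"
proof -
  define \<phi> where "\<phi> = (\<lambda>X. ((X - a) / (1 - X * a) * ((X - b) / (1 - X * b))) ^ 2)"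
  define d where "d = (\<lambda>s X :: complex. 4 * (1 - s * X + X ^ 2) / (1 - X ^ 2) ^ 2)"
  define g where "g = (\<lambda>X. d s X * \<phi> (X * d s X) - \<phi> X * d s' (X * \<phi> X))"
  have quintic: "quintic_map a b X = X * \<phi> X" for X
    by (simp add: quintic_map_def \<phi>_def)
  have double: "double_map s X = X * d s X" for s X
    by (simp add: double_map_def d_def)
  have \<phi>0: "\<phi> 0 = (a * b) ^ 2" and d0: "d s 0 = 4" for s
    by (simp_all add: \<phi>_def d_def)
  define \<phi>' where "\<phi>' = 2 * (a * b) * (a + b) * (a * b - 1)"
  have \<phi>_deriv: "(\<phi> has_field_derivative \<phi>') (at 0)"
  proof -
    have f: "((\<lambda>X. (X - c) / (1 - X * c)) has_field_derivative 1 - c ^ 2) (at 0)" for c :: complex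
      by (auto intro!: derivative_eq_intros simp: power2_eq_square)
    show ?thesis
      unfolding \<phi>_def
      by (rule DERIV_cong[OF DERIV_power[OF DERIV_mult[OF f f]]])
         (simp add: \<phi>'_def algebra_simps power2_eq_square)
  qed
  have d_deriv: "(d s has_field_derivative (- 4 * s)) (at 0)" for s
  proof -
    have "((\<lambda>X. 4 * (1 - s * X + X ^ 2)) has_field_derivative - 4 * s) (at 0)"
      by (auto intro!: derivative_eq_intros)
    moreover have "((\<lambda>X::complex. (1 - X ^ 2) ^ 2) has_field_derivative 0) (at 0)"
      by (auto intro!: derivative_eq_intros)
    ultimately show ?thesis
      unfolding d_def by (auto dest: DERIV_divide)
  qed
  have 1: "((\<lambda>X. X * d s X) has_field_derivative 4) (at 0)"
    using DERIV_mult[OF DERIV_ident d_deriv[of s]] by (simp add: d0)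
  have 2: "((\<lambda>X. \<phi> (X * d s X)) has_field_derivative \<phi>' * 4) (at 0)"
    by (rule DERIV_chain2[OF _ 1]) (simp add: \<phi>_deriv)
  have 3: "((\<lambda>X. X * \<phi> X) has_field_derivative (a * b) ^ 2) (at 0)"
    using DERIV_mult[OF DERIV_ident \<phi>_deriv] by (simp add: \<phi>0)
  have 4: "((\<lambda>X. d s' (X * \<phi> X)) has_field_derivative (- 4 * s') * (a * b) ^ 2) (at 0)"
    by (rule DERIV_chain2[OF _ 3]) (simp add: d_deriv[of s', simplified])
  define g' where "g' = - 4 * s * (a * b) ^ 2 + 12 * \<phi>' + 4 * s' * (a * b) ^ 4"
  have "(g has_field_derivative g') (at 0)"
    unfolding g_def
    by (rule DERIV_cong[OF DERIV_diff[OF DERIV_mult[OF d_deriv 2] DERIV_mult[OF \<phi>_deriv 4]]])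
       (unfold g'_def \<phi>0 d0 mult_zero_left \<phi>0 d0, algebra)
  moreover have "g 0 = 0" by (simp add: g_def d0 \<phi>0)
  ultimately have "((\<lambda>h. g h / h) \<longlongrightarrow> g') (at 0)"
    by (simp add: has_field_derivative_iff)
  hence "((\<lambda>v. g (X v) / X v) \<longlongrightarrow> g') F"
    by (rule filterlim_compose[OF _ X])
  moreover have "eventually (\<lambda>v. g (X v) / X v = 0) F"
  proof -
    have "eventually (\<lambda>v. X v \<noteq> 0) F"
      using X by (auto simp: filterlim_at)
    with eq show ?thesis
    proof eventually_elim
      case (elim v)
      hence "X v * g (X v) = 0"
        by (simp add: g_def quintic double right_diff_distrib mult.assoc)
      thus ?case by auto
    qed
  qed
  ultimately have "((\<lambda>v. 0) \<longlongrightarrow> g') F"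
    by (rule Lim_transform_eventually)
  hence "g' = 0"
    by (rule tendsto_unique[OF F _ tendsto_const])
  moreover have "4 * P * (6 * S * (P - 1) - P * (s - s' * P ^ 2)) =
      - 4 * s * P ^ 2 + 12 * (2 * P * S * (P - 1)) + 4 * s' * P ^ 4" for P S
    by algebra
  ultimately have "4 * (a * b) * (6 * (a + b) * (a * b - 1) - a * b * (s - s' * (a * b) ^ 2)) = 0"
    unfolding g'_def \<phi>'_def by (simp only:)
  thus ?thesis using nz by simp
qed

lemma isCont_theta1: "Im \<tau> > 0 \<Longrightarrow> isCont (\<lambda>v. theta1 v \<tau>) v"
  using theta2_has_deriv[of \<tau> "v - of_real pi / 2"] DERIV_isCont isCont_o2[of v "\<lambda>v. v - of_real pi / 2" "\<lambda>v. theta2 v \<tau>"]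
  unfolding theta1_def by force

lemma isCont_theta4: "Im \<tau> > 0 \<Longrightarrow> isCont (\<lambda>v. theta4 v \<tau>) v"
proof -
  assume "Im \<tau> > 0"
  hence "isCont (\<lambda>v. theta3 v \<tau>) (v - of_real pi / 2)"
    unfolding theta3_conv_nome
    by (intro field_differentiable_imp_continuous_at theta3_nome_differentiable norm_nome_less_1)
  thus ?thesis
    unfolding theta4_def by (rule isCont_o2[rotated]) auto
qed

lemma eventually_theta4_nonzero_at_0:
  assumes "Im \<tau> > 0" "theta4 0 \<tau> \<noteq> 0"
  shows "eventually (\<lambda>v. theta4 (c * v) \<tau> \<noteq> 0) (at 0)"
proof -
  have "isCont (\<lambda>v. theta4 (c * v) \<tau>) 0"
    by (rule isCont_o2[OF _ isCont_theta4[OF assms(1)]]) auto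
  hence "((\<lambda>v. theta4 (c * v) \<tau>) \<longlongrightarrow> theta4 0 \<tau>) (at 0)"
    by (simp add: isCont_def)
  thus ?thesis using assms(2) by (rule tendsto_imp_eventually_ne)
qed

lemma filterlim_theta_quot_0:
  assumes \<tau>: "Im \<tau> > 0" and nz: "theta4 0 \<tau> \<noteq> 0" "theta1_deriv \<tau> \<noteq> 0"
  shows "filterlim (\<lambda>v. theta_quot v \<tau>) (at 0) (at 0)"
  unfolding filterlim_at
proof
  have "isCont (\<lambda>v. theta_quot v \<tau>) 0"
    unfolding theta_quot_def using nz by (intro continuous_intros isCont_theta1 isCont_theta4 \<tau>) auto
  thus "((\<lambda>v. theta_quot v \<tau>) \<longlongrightarrow> 0) (at 0)"
    by (simp add: isCont_def theta_quot_def)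
  have "((\<lambda>v. theta1 v \<tau> / v) \<longlongrightarrow> theta1_deriv \<tau>) (at 0)"
    using theta1_has_deriv[OF \<tau>] by (simp add: has_field_derivative_iff)
  hence "eventually (\<lambda>v. theta1 v \<tau> / v \<noteq> 0) (at 0)"
    using nz(2) by (rule tendsto_imp_eventually_ne)
  moreover have "eventually (\<lambda>v. theta4 (1 * v) \<tau> \<noteq> 0) (at 0)"
    by (rule eventually_theta4_nonzero_at_0) fact+
  ultimately show "eventually (\<lambda>v. theta_quot v \<tau> \<in> UNIV \<and> theta_quot v \<tau> \<noteq> 0) (at 0)"
    by eventually_elim (auto simp: theta_quot_def)
qed

text \<open>
  The product relation comes from dividing the quintic product formula for \<open>\<theta>\<^sub>1\<close> by \<open>v\<close> and letting \<open>v\<close> tend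
  to 0, divided by the formula for \<open>\<theta>\<^sub>4\<close> at \<open>v = 0\<close>. The second relation comes from computing \<open>X(10 v, 5\<tau>)\<close> in two
  ways.
\<close>

lemma quintic_relations:
  assumes \<tau>: "Im \<tau> > 0"
    and nz: "theta2 0 \<tau> \<noteq> 0" "theta3 0 \<tau> \<noteq> 0" "theta4 0 \<tau> \<noteq> 0"
            "theta2 0 (5 * \<tau>) \<noteq> 0" "theta3 0 (5 * \<tau>) \<noteq> 0" "theta4 0 (5 * \<tau>) \<noteq> 0"
            "theta4 (of_real (pi/5)) \<tau> \<noteq> 0" "theta4 (of_real (2*pi/5)) \<tau> \<noteq> 0"
    and jacobi: "theta1_deriv \<tau> = theta2 0 \<tau> * theta3 0 \<tau> * theta4 0 \<tau>"
                "theta1_deriv (5 * \<tau>) = theta2 0 (5 * \<tau>) * theta3 0 (5 * \<tau>) * theta4 0 (5 * \<tau>)"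
  defines "a \<equiv> theta_quot (of_real (pi/5)) \<tau>" and "b \<equiv> theta_quot (of_real (2*pi/5)) \<tau>"
  shows "a * b = 5 * theta2 0 (5 * \<tau>) * theta3 0 (5 * \<tau>) / (theta2 0 \<tau> * theta3 0 \<tau>)"
    and "6 * (a + b) * (a * b - 1) = a * b * (modulus_sum \<tau> - modulus_sum (5 * \<tau>) * (a * b) ^ 2)"
proof -
  have \<tau>5: "Im (5 * \<tau>) > 0" using \<tau> by simp
  define x y where "x = complex_of_real (pi/5)" and "y = complex_of_real (2*pi/5)"
  obtain C where
    C1: "\<And>v. theta1 v \<tau> * (theta1 (v + x) \<tau> * theta1 (v - x) \<tau>) *
         (theta1 (v + y) \<tau> * theta1 (v - y) \<tau>) = C * theta1 (5 * v) (5 * \<tau>)" and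
    C4: "\<And>v. theta4 v \<tau> * (theta4 (v + x) \<tau> * theta4 (v - x) \<tau>) *
         (theta4 (v + y) \<tau> * theta4 (v - y) \<tau>) = C * theta4 (5 * v) (5 * \<tau>)"
    unfolding x_def y_def by (rule theta_quintic[OF \<tau>]) blast
  have nz': "theta4 x \<tau> \<noteq> 0" "theta4 y \<tau> \<noteq> 0"
    using nz by (simp_all only: x_def y_def not_False_eq_True)
  have C4_0: "theta4 0 \<tau> * (theta4 x \<tau> ^ 2 * theta4 y \<tau> ^ 2) = C * theta4 0 (5 * \<tau>)"
    using C4[of 0] by (simp add: theta4_minus power2_eq_square mult_ac)
  hence C: "C \<noteq> 0" using nz nz' by auto

  have C1_0: "theta1_deriv \<tau> * (theta1 x \<tau> ^ 2 * theta1 y \<tau> ^ 2) = 5 * C * theta1_deriv (5 * \<tau>)"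
  proof -
    have "((\<lambda>v. theta1 (5 * v) (5 * \<tau>)) has_field_derivative theta1_deriv (5 * \<tau>) * 5) (at 0)"
      by (rule DERIV_chain2[where g = "\<lambda>x. 5 * x"])
         (use theta1_has_deriv[OF \<tau>5] in \<open>auto intro!: derivative_eq_intros\<close>)
    hence "((\<lambda>v. theta1 (5 * v) (5 * \<tau>) / v) \<longlongrightarrow> theta1_deriv (5 * \<tau>) * 5) (at 0)"
      by (simp add: has_field_derivative_iff)
    hence 1: "((\<lambda>v. C * (theta1 (5 * v) (5 * \<tau>) / v)) \<longlongrightarrow> C * (theta1_deriv (5 * \<tau>) * 5)) (at 0)"
      by (intro tendsto_intros)
    have lim: "((\<lambda>v. theta1 (v + c) \<tau>) \<longlongrightarrow> theta1 c \<tau>) (at 0)" for c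
    proof -
      have "isCont (\<lambda>v. theta1 (v + c) \<tau>) 0"
        by (rule isCont_o2[OF _ isCont_theta1[OF \<tau>]]) auto
      thus ?thesis by (simp add: isCont_def)
    qed
    have "((\<lambda>v. theta1 v \<tau> / v) \<longlongrightarrow> theta1_deriv \<tau>) (at 0)"
      using theta1_has_deriv[OF \<tau>] by (simp add: has_field_derivative_iff)
    hence "((\<lambda>v. theta1 v \<tau> / v * (theta1 (v + x) \<tau> * theta1 (v + (-x)) \<tau>) *
         (theta1 (v + y) \<tau> * theta1 (v + (-y)) \<tau>)) \<longlongrightarrow>
         theta1_deriv \<tau> * (theta1 x \<tau> * theta1 (-x) \<tau>) * (theta1 y \<tau> * theta1 (-y) \<tau>)) (at 0)"
      by (intro tendsto_mult lim)
    also have "(\<lambda>v. theta1 v \<tau> / v * (theta1 (v + x) \<tau> * theta1 (v + (-x)) \<tau>) *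
         (theta1 (v + y) \<tau> * theta1 (v + (-y)) \<tau>)) = (\<lambda>v. C * (theta1 (5 * v) (5 * \<tau>) / v))"
    proof
      fix v
      show "theta1 v \<tau> / v * (theta1 (v + x) \<tau> * theta1 (v + (-x)) \<tau>) *
         (theta1 (v + y) \<tau> * theta1 (v + (-y)) \<tau>) = C * (theta1 (5 * v) (5 * \<tau>) / v)"
        using arg_cong[OF C1[of v], of "\<lambda>z. z / v"] by simp
    qed
    finally have "theta1_deriv \<tau> * (theta1 x \<tau> * theta1 (-x) \<tau>) * (theta1 y \<tau> * theta1 (-y) \<tau>) =
        C * (theta1_deriv (5 * \<tau>) * 5)"
      by (rule tendsto_unique[OF trivial_limit_at _ 1])
    thus ?thesis by (simp add: theta1_minus power2_eq_square mult_ac)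
  qed

  have ab: "a * b = (theta1 x \<tau> ^ 2 * theta1 y \<tau> ^ 2) / (theta4 x \<tau> ^ 2 * theta4 y \<tau> ^ 2)"
    unfolding a_def b_def theta_quot_def x_def y_def by simp
  have "theta1 x \<tau> ^ 2 * theta1 y \<tau> ^ 2 = 5 * C * theta1_deriv (5 * \<tau>) / theta1_deriv \<tau>"
    using C1_0 nz jacobi(1) by (simp add: eq_divide_eq mult_ac)
  moreover have "theta4 x \<tau> ^ 2 * theta4 y \<tau> ^ 2 = C * theta4 0 (5 * \<tau>) / theta4 0 \<tau>"
    using C4_0 nz by (simp add: eq_divide_eq mult_ac)
  ultimately show prod: "a * b = 5 * theta2 0 (5 * \<tau>) * theta3 0 (5 * \<tau>) / (theta2 0 \<tau> * theta3 0 \<tau>)"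
    unfolding ab using C nz by (simp add: jacobi)

  have quintic: "theta_quot (5 * v) (5 * \<tau>) = quintic_map a b (theta_quot v \<tau>)" if "theta4 v \<tau> \<noteq> 0" for v
  proof -
    have "theta_quot (5 * v) (5 * \<tau>) = (C * theta1 (5 * v) (5 * \<tau>)) ^ 2 / (C * theta4 (5 * v) (5 * \<tau>)) ^ 2"
      using C by (simp add: theta_quot_def power_mult_distrib)
    also have "\<dots> = theta_quot v \<tau> * ((theta_quot (v + x) \<tau> * theta_quot (v - x) \<tau>) *
                      (theta_quot (v + y) \<tau> * theta_quot (v - y) \<tau>))"
      unfolding C1[symmetric] C4[symmetric] by (simp add: theta_quot_def power_mult_distrib mult_ac)
    also have "\<dots> = quintic_map a b (theta_quot v \<tau>)"
      using theta_quot_add[OF \<tau> nz(3) that nz'(1)] theta_quot_add[OF \<tau> nz(3) that nz'(2)]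
      by (simp only: quintic_map_def a_def b_def x_def y_def power_mult_distrib)
    finally show ?thesis .
  qed

  show "6 * (a + b) * (a * b - 1) = a * b * (modulus_sum \<tau> - modulus_sum (5 * \<tau>) * (a * b) ^ 2)"
  proof (rule quintic_double_coefficient)
    show "filterlim (\<lambda>v. theta_quot v \<tau>) (at 0) (at (0 :: complex))"
      by (rule filterlim_theta_quot_0) (use \<tau> nz jacobi in auto)
    have "eventually (\<lambda>v. theta4 (1 * v) \<tau> \<noteq> 0) (at 0)" "eventually (\<lambda>v. theta4 (2 * v) \<tau> \<noteq> 0) (at 0)"
         "eventually (\<lambda>v. theta4 (5 * v) (5 * \<tau>) \<noteq> 0) (at 0)"
      by (rule eventually_theta4_nonzero_at_0; fact)+
    thus "eventually (\<lambda>v. quintic_map a b (double_map (modulus_sum \<tau>) (theta_quot v \<tau>)) =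
             double_map (modulus_sum (5 * \<tau>)) (quintic_map a b (theta_quot v \<tau>))) (at 0)"
    proof eventually_elim
      case (elim v)
      have "quintic_map a b (double_map (modulus_sum \<tau>) (theta_quot v \<tau>)) = quintic_map a b (theta_quot (2 * v) \<tau>)"
        using theta_quot_double[OF \<tau> nz(1-3), of v] elim by (simp add: double_map_def)
      also have "\<dots> = theta_quot (2 * (5 * v)) (5 * \<tau>)"
        using quintic[of "2 * v"] elim by (simp add: mult_ac)
      also have "\<dots> = double_map (modulus_sum (5 * \<tau>)) (theta_quot (5 * v) (5 * \<tau>))"
        using theta_quot_double[OF \<tau>5 nz(4-6), of "5 * v"] elim by (simp add: double_map_def)
      also have "theta_quot (5 * v) (5 * \<tau>) = quintic_map a b (theta_quot v \<tau>)"
        using quintic[of v] elim by simp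
      finally show ?case .
    qed
    show "a * b \<noteq> 0" using prod nz by simp
  qed auto
qed

section \<open>Continuation to the upper half plane\<close>

lemma holomorphic_on_theta:
  shows "theta2 v holomorphic_on upper_half_plane" and "theta3 v holomorphic_on upper_half_plane"
proof -
  have nome: "nome holomorphic_on upper_half_plane" "nome ` upper_half_plane \<subseteq> ball 0 1"
    unfolding nome_def[abs_def] upper_half_plane_def
    by (auto intro!: holomorphic_intros simp: zero_less_mult_iff)
  have q: "(\<lambda>\<tau>. q_pow \<tau> s) holomorphic_on upper_half_plane" for s
    unfolding q_pow_def by (intro holomorphic_intros)
  show "theta3 v holomorphic_on upper_half_plane"
    unfolding theta3_conv_nome[abs_def]
    using holomorphic_on_compose_gen[OF nome(1) holomorphic_theta_nome(1) nome(2)] by (simp add: o_def)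
  have "(\<lambda>\<tau>. theta2_nome v (nome \<tau>)) holomorphic_on upper_half_plane"
    using holomorphic_on_compose_gen[OF nome(1) holomorphic_theta_nome(2) nome(2)] by (simp add: o_def)
  thus "theta2 v holomorphic_on upper_half_plane"
    unfolding theta2_conv_nome[abs_def] by (intro holomorphic_on_mult q)
qed

lemma open_upper_half_plane: "open upper_half_plane"
  unfolding upper_half_plane_def by (rule open_halfspace_Im_gt)

lemma meromorphic_on_theta:
  shows "(\<lambda>\<tau>. theta2 v \<tau>) meromorphic_on upper_half_plane"
    and "(\<lambda>\<tau>. theta3 v \<tau>) meromorphic_on upper_half_plane"
    and "(\<lambda>\<tau>. theta2 v (5 * \<tau>)) meromorphic_on upper_half_plane"
    and "(\<lambda>\<tau>. theta3 v (5 * \<tau>)) meromorphic_on upper_half_plane"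
proof -
  have mero: "f meromorphic_on upper_half_plane" if "f holomorphic_on upper_half_plane" for f
    using that open_upper_half_plane analytic_on_open analytic_on_imp_meromorphic_on by blast
  have 5: "(\<lambda>\<tau>. 5 * \<tau>) holomorphic_on upper_half_plane" "(\<lambda>\<tau>. 5 * \<tau>) ` upper_half_plane \<subseteq> upper_half_plane"
    by (auto intro!: holomorphic_intros simp: upper_half_plane_def)
  show "(\<lambda>\<tau>. theta2 v \<tau>) meromorphic_on upper_half_plane"
       "(\<lambda>\<tau>. theta3 v \<tau>) meromorphic_on upper_half_plane"
    by (rule mero holomorphic_on_theta)+
  show "(\<lambda>\<tau>. theta2 v (5 * \<tau>)) meromorphic_on upper_half_plane"
    using holomorphic_on_compose_gen[OF 5(1) holomorphic_on_theta(1) 5(2)] by (intro mero) (simp add: o_def)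
  show "(\<lambda>\<tau>. theta3 v (5 * \<tau>)) meromorphic_on upper_half_plane"
    using holomorphic_on_compose_gen[OF 5(1) holomorphic_on_theta(2) 5(2)] by (intro mero) (simp add: o_def)
qed

text \<open>
  The difference of the two functions is either zero or nonzero outside a sparse set. It vanishes on a
  nonempty open set high up in the half plane, which rules out the second case.
\<close>

lemma meromorphic_identity_onI_cusp:
  assumes f: "f meromorphic_on upper_half_plane" and g: "g meromorphic_on upper_half_plane"
    and eq: "eventually (\<lambda>\<tau>. f \<tau> = g \<tau>) cusp"
  shows "meromorphic_identity_on upper_half_plane f g"
proof -
  have "connected upper_half_plane"
    unfolding upper_half_plane_def by (intro convex_connected convex_halfspace_Im_gt)
  moreover have "(\<lambda>\<tau>. f \<tau> - g \<tau>) meromorphic_on upper_half_plane"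
    using f g by (rule meromorphic_on_diff)
  ultimately consider "eventually (\<lambda>\<tau>. f \<tau> - g \<tau> = 0) (cosparse upper_half_plane)"
    | "eventually (\<lambda>\<tau>. f \<tau> - g \<tau> \<noteq> 0) (cosparse upper_half_plane)"
    using meromorphic_imp_constant_or_avoid open_upper_half_plane by blast
  thus ?thesis
  proof cases
    case 1
    thus ?thesis using f g by (simp add: meromorphic_identity_on_def)
  next
    case 2
    obtain \<epsilon> where \<epsilon>: "\<epsilon> > 0" and eq': "\<And>\<tau>. norm (nome \<tau>) < \<epsilon> \<Longrightarrow> f \<tau> = g \<tau>"
      using eq unfolding eventually_cusp by blast
    define U where "U = {\<tau>. norm (nome \<tau>) < \<epsilon>}"
    have "open U"
      unfolding U_def nome_def by (intro open_Collect_less continuous_intros)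
    define L where "L = \<bar>ln \<epsilon>\<bar> + 1"
    \<comment> \<open>A point of nome below \<open>\<epsilon>\<close>: its nome is \<open>exp (- 2 \<pi> L)\<close>, and \<open>- 2 \<pi> L < ln \<epsilon>\<close>.\<close>
    define \<tau>0 where "\<tau>0 = \<i> * of_real L"
    have "1 * L \<le> 2 * pi * L"
      unfolding L_def using pi_gt3 by (intro mult_right_mono) auto
    moreover have "- L < ln \<epsilon>" by (simp add: L_def)
    ultimately have "- (2 * pi * L) < ln \<epsilon>" by linarith
    hence "exp (- (2 * pi * L)) < \<epsilon>"
      using \<epsilon> by (metis exp_less_mono exp_ln)
    hence "\<tau>0 \<in> U" by (simp add: U_def nome_def \<tau>0_def)
    hence "eventually (\<lambda>\<tau>. \<tau> \<in> U) (at \<tau>0)"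
      using \<open>open U\<close> by (simp add: eventually_at_in_open')
    moreover have "\<tau>0 \<in> upper_half_plane" by (simp add: upper_half_plane_def \<tau>0_def L_def)
    with 2 have "eventually (\<lambda>\<tau>. f \<tau> - g \<tau> \<noteq> 0) (at \<tau>0)"
      using eventually_cosparse_imp_eventually_at[of _ upper_half_plane \<tau>0 UNIV] by blast
    ultimately have "eventually (\<lambda>\<tau>. False) (at \<tau>0)"
      by eventually_elim (use eq' in \<open>auto simp: U_def\<close>)
    thus ?thesis by simp
  qed
qed

text \<open>
  Both products have order \<open>q\<^sup>1\<^sup>/\<^sup>4\<close> or higher; only the second has a term in \<open>q\<^sup>1\<^sup>/\<^sup>4\<close>, with coefficient 2.
\<close>

lemma multiplier_nonzero_near_cusp:
  "eventually (\<lambda>\<tau>. 5 * theta2 0 (5 * \<tau>) * theta3 0 (5 * \<tau>) - theta2 0 \<tau> * theta3 0 \<tau> \<noteq> 0) cusp"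
proof -
  have scale: "filterlim (\<lambda>\<tau>. 5 * \<tau>) cusp cusp"
    using filterlim_cusp_scale[of 5] by simp
  have "((\<lambda>\<tau>. 5 * nome \<tau> * theta2_nome 0 (nome (5 * \<tau>)) * theta3 0 (5 * \<tau>) - theta2_nome 0 (nome \<tau>) * theta3 0 \<tau>)
          \<longlongrightarrow> 5 * 0 * (2 * cos 0) * 1 - (2 * cos 0) * 1) cusp"
    by (intro tendsto_intros filterlim_nome_cusp theta2_nome_tendsto_cusp theta3_tendsto_cusp
          filterlim_compose[OF theta2_nome_tendsto_cusp scale] filterlim_compose[OF theta3_tendsto_cusp scale])
  hence "eventually (\<lambda>\<tau>. 5 * nome \<tau> * theta2_nome 0 (nome (5 * \<tau>)) * theta3 0 (5 * \<tau>) - theta2_nome 0 (nome \<tau>) * theta3 0 \<tau> \<noteq> 0) cusp"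
    by (rule tendsto_imp_eventually_ne) simp
  thus ?thesis
  proof eventually_elim
    case (elim \<tau>)
    have "q_pow (5 * \<tau>) (1/4) = q_pow \<tau> (1/4) * nome \<tau>"
      by (simp add: q_pow_def nome_def mult_ac flip: exp_add)
    hence "5 * theta2 0 (5 * \<tau>) * theta3 0 (5 * \<tau>) - theta2 0 \<tau> * theta3 0 \<tau> =
       q_pow \<tau> (1/4) * (5 * nome \<tau> * theta2_nome 0 (nome (5 * \<tau>)) * theta3 0 (5 * \<tau>) - theta2_nome 0 (nome \<tau>) * theta3 0 \<tau>)"
      by (simp add: theta2_conv_nome right_diff_distrib mult_ac)
    thus ?case using elim by simp
  qed
qed

lemma theta_quot_eq:
  "theta_quot (of_real (2 * pi / 5)) \<tau> = theta2 (of_real (pi / 10)) \<tau> ^ 2 / theta3 (of_real (pi / 10)) \<tau> ^ 2"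
  "theta_quot (of_real (pi / 5)) \<tau> = theta2 (of_real (3 * pi / 10)) \<tau> ^ 2 / theta3 (of_real (3 * pi / 10)) \<tau> ^ 2"
proof -
  have "complex_of_real (2 * pi / 5) - of_real pi / 2 = - of_real (pi / 10)"
       "complex_of_real (pi / 5) - of_real pi / 2 = - of_real (3 * pi / 10)"
    by (simp_all add: field_simps)
  thus "theta_quot (of_real (2 * pi / 5)) \<tau> = theta2 (of_real (pi / 10)) \<tau> ^ 2 / theta3 (of_real (pi / 10)) \<tau> ^ 2"
       "theta_quot (of_real (pi / 5)) \<tau> = theta2 (of_real (3 * pi / 10)) \<tau> ^ 2 / theta3 (of_real (3 * pi / 10)) \<tau> ^ 2"
    by (simp_all only: theta_quot_def theta1_def theta4_def theta2_minus theta3_minus)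
qed

lemma sum_formula_algebra:
  fixes A B :: complex
  assumes nz: "A \<noteq> 0" "B \<noteq> 0" "5 * A - B \<noteq> 0"
    and P: "P = 5 * A / B"
    and S: "6 * S * (P - 1) = P * (K / B ^ 2 - K5 / A ^ 2 * P ^ 2)"
  shows "S = 5 * A / (6 * B ^ 2) * ((K - 25 * K5) / (5 * A - B))"
proof -
  have "6 * S * (P - 1) = 6 * S * (5 * A - B) / B"
    using nz by (simp add: P field_simps)
  moreover have "P * (K / B ^ 2 - K5 / A ^ 2 * P ^ 2) = 5 * A * (K - 25 * K5) / B ^ 3"
    using nz by (simp add: P field_simps power2_eq_square power3_eq_cube)
  ultimately have "6 * S * (5 * A - B) / B = 5 * A * (K - 25 * K5) / B ^ 3"
    using S by simp
  hence "6 * S * (5 * A - B) / B * B ^ 3 = 5 * A * (K - 25 * K5) / B ^ 3 * B ^ 3"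
    by simp
  hence "6 * S * (5 * A - B) * B ^ 2 = 5 * A * (K - 25 * K5)"
    using nz by (simp add: power2_eq_square power3_eq_cube mult.assoc)
  hence "S * (6 * B ^ 2 * (5 * A - B)) = 5 * A * (K - 25 * K5)"
    by (simp only: mult_ac)
  thus ?thesis using nz by (simp add: nonzero_eq_divide_eq)
qed

lemma quintic_identities_near_cusp:
  "eventually (\<lambda>\<tau>. 
     theta2 (of_real (pi / 10)) \<tau> ^ 2 / theta3 (of_real (pi / 10)) \<tau> ^ 2
         + theta2 (of_real (3 * pi / 10)) \<tau> ^ 2 / theta3 (of_real (3 * pi / 10)) \<tau> ^ 2 =
     (5 * theta2 0 (5 * \<tau>) * theta3 0 (5 * \<tau>)) / (6 * theta2 0 \<tau> ^ 2 * theta3 0 \<tau> ^ 2)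
         * ((theta3 0 \<tau> ^ 4 + theta2 0 \<tau> ^ 4
               - 25 * (theta3 0 (5 * \<tau>) ^ 4 + theta2 0 (5 * \<tau>) ^ 4))
            / (5 * theta2 0 (5 * \<tau>) * theta3 0 (5 * \<tau>) - theta2 0 \<tau> * theta3 0 \<tau>)) \<and>
     (theta2 (of_real (pi / 10)) \<tau> ^ 2 / theta3 (of_real (pi / 10)) \<tau> ^ 2)
         * (theta2 (of_real (3 * pi / 10)) \<tau> ^ 2 / theta3 (of_real (3 * pi / 10)) \<tau> ^ 2) =
     (5 * theta2 0 (5 * \<tau>) * theta3 0 (5 * \<tau>)) / (theta2 0 \<tau> * theta3 0 \<tau>)) cusp"
proof -
  have scale: "filterlim (\<lambda>\<tau>. 5 * \<tau>) cusp cusp"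
    using filterlim_cusp_scale[of 5] by simp
  have ev5: "eventually (\<lambda>\<tau>. P (5 * \<tau>)) cusp" if "eventually P cusp" for P
    using scale that by (rule eventually_compose_filterlim[rotated])
  have th2: "eventually (\<lambda>\<tau>. theta2 0 \<tau> \<noteq> 0) cusp"
    by (rule eventually_theta2_nonzero) auto
  have th4: "eventually (\<lambda>\<tau>. theta4 v \<tau> \<noteq> 0) cusp" for v
    unfolding theta4_def by (rule eventually_theta3_nonzero)
  note events = eventually_cusp_Im_pos th2 eventually_theta3_nonzero[of 0] th4[of 0]
    ev5[OF th2] ev5[OF eventually_theta3_nonzero[of 0]] ev5[OF th4[of 0]]
    th4[of "of_real (pi/5)"] th4[of "of_real (2*pi/5)"]
    jacobi_derivative_near_cusp ev5[OF jacobi_derivative_near_cusp] multiplier_nonzero_near_cusp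
  show ?thesis using events
  proof eventually_elim
    case (elim \<tau>)
    define a where "a = theta_quot (of_real (pi/5)) \<tau>"
    define b where "b = theta_quot (of_real (2*pi/5)) \<tau>"
    define A where "A = theta2 0 (5 * \<tau>) * theta3 0 (5 * \<tau>)"
    define B where "B = theta2 0 \<tau> * theta3 0 \<tau>"
    note rel = quintic_relations[OF elim(1-11), folded a_def b_def]
    have prod: "a * b = 5 * A / B"
      using rel(1) by (simp add: A_def B_def mult.assoc)
    have "a + b = 5 * A / (6 * B ^ 2) * ((theta3 0 \<tau> ^ 4 + theta2 0 \<tau> ^ 4 
               - 25 * (theta3 0 (5 * \<tau>) ^ 4 + theta2 0 (5 * \<tau>) ^ 4)) / (5 * A - B))"
    proof (rule sum_formula_algebra[OF _ _ _ prod])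
      show "6 * (a + b) * (a * b - 1) = a * b * ((theta3 0 \<tau> ^ 4 + theta2 0 \<tau> ^ 4) / B\<^sup>2 -
             (theta3 0 (5 * \<tau>) ^ 4 + theta2 0 (5 * \<tau>) ^ 4) / A\<^sup>2 * (a * b)\<^sup>2)"
        using rel(2) by (simp only: modulus_sum_def A_def B_def power_mult_distrib)
    qed (use elim in \<open>auto simp: A_def B_def mult.assoc\<close>)
    with prod show ?case
      unfolding theta_quot_eq[symmetric] a_def[symmetric] b_def[symmetric]
      by (simp add: A_def B_def power_mult_distrib mult.assoc add.commute[of b] mult.commute[of b])
  qed
qed

theorem mainTheorem8:
  shows "meromorphic_identity_on upper_half_plane
      (\<lambda>\<tau>. theta2 (of_real (pi / 10)) \<tau> ^ 2 / theta3 (of_real (pi / 10)) \<tau> ^ 2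
         + theta2 (of_real (3 * pi / 10)) \<tau> ^ 2 / theta3 (of_real (3 * pi / 10)) \<tau> ^ 2)
      (\<lambda>\<tau>. (5 * theta2 0 (5 * \<tau>) * theta3 0 (5 * \<tau>)) / (6 * theta2 0 \<tau> ^ 2 * theta3 0 \<tau> ^ 2)
         * ((theta3 0 \<tau> ^ 4 + theta2 0 \<tau> ^ 4
               - 25 * (theta3 0 (5 * \<tau>) ^ 4 + theta2 0 (5 * \<tau>) ^ 4))
            / (5 * theta2 0 (5 * \<tau>) * theta3 0 (5 * \<tau>) - theta2 0 \<tau> * theta3 0 \<tau>)))
    \<and> meromorphic_identity_on upper_half_plane
      (\<lambda>\<tau>. (theta2 (of_real (pi / 10)) \<tau> ^ 2 / theta3 (of_real (pi / 10)) \<tau> ^ 2)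
         * (theta2 (of_real (3 * pi / 10)) \<tau> ^ 2 / theta3 (of_real (3 * pi / 10)) \<tau> ^ 2))
      (\<lambda>\<tau>. (5 * theta2 0 (5 * \<tau>) * theta3 0 (5 * \<tau>)) / (theta2 0 \<tau> * theta3 0 \<tau>))"
  using quintic_identities_near_cusp
  by (intro conjI meromorphic_identity_onI_cusp meromorphic_intros meromorphic_on_theta)
     (auto elim: eventually_mono)

end
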